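(* Let $b\ge3$, $D\subset\{0,\dots,b-1\}$ with $0\in D$ and $2\le|D|<b$, and list $\mathcal C=\mathcal C_{b,D}$ increasingly as $k_1<k_2<\cdots$. Let $P(x,y)=\sum_{i,j}c_{ij}x^iy^j$ be a real polynomial such that $c_{ij}$ is irrational for some $(i,j)\neq(0,0)$. Then $$\lim_{N-M\to\infty}\frac1{N-M}\sum_{M<n\le N}e\big(P(k_n,s_b(k_n))\big)=0$$ (uniformly in $M$: for every $\eta>0$ there is $L$ such that the average has modulus $<\eta$ whenever $0\le M<N$, $N-M\ge L$). Consequently, for every polynomial map $p=(p_1,p_2):\mathbb R^2\to\mathbb R^2$ such that $m\cdot p$ has an irrational non-constant coefficient for every $m\in\mathbb Z^2\setminus\{0\}$, the sequence $p(k_n,s_b(k_n))$ is uniformly distributed modulo $1$ in $[0,1)^2$, and the averages of $e(m\cdot p(k_n,s_b(k_n)))$ over $M<n\le N$ tend to $0$ as $N-M\to\infty$ for every $m\in\mathbb Z^2\setminus\{0\}$.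
   Context: $\mathcal C_{b,D}=\{\sum_{j=0}^{k} d_j b^j : k\in\mathbb N_0,\ d_j\in D\}$; $s_b(k)$ is the base-$b$ sum of digits; $e(x)=e^{2\pi ix}$. A sequence $(x_n)\subset\mathbb R^2$ is uniformly distributed mod 1 if the fractional parts satisfy $\frac1N\#\{n\le N:\{x_n\}\in(a,b)\times(c,d)\}\to(b-a)(d-c)$ for all subrectangles of $[0,1)^2$. *)

theory Defs
  imports "HOL-Analysis.Analysis" "HOL-Library.Infinite_Set"
begin

definition digit_set :: "nat \<Rightarrow> nat set \<Rightarrow> nat set" where
  "digit_set b D = {(\<Sum>j\<le>k. d j * b ^ j) | k d. \<forall>j\<le>k. d j \<in> D}"

text \<open>k_n, n = 1,2,...: the n-th element of C_{b,D} in increasing order (enumerate is 0-based).\<close>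
definition kseq :: "nat \<Rightarrow> nat set \<Rightarrow> nat \<Rightarrow> nat" where
  "kseq b D n = enumerate (digit_set b D) (n - 1)"

text \<open>Base-b sum of digits (digits beyond position k vanish since b^j > k for j > k when b >= 2).\<close>
definition digsum :: "nat \<Rightarrow> nat \<Rightarrow> nat" where
  "digsum b k = (\<Sum>j\<le>k. (k div b ^ j) mod b)"

definition ee :: "real \<Rightarrow> complex" where
  "ee x = exp (2 * of_real pi * \<i> * of_real x)"

definition poly2 :: "nat \<Rightarrow> (nat \<Rightarrow> nat \<Rightarrow> real) \<Rightarrow> real \<Rightarrow> real \<Rightarrow> real" where
  "poly2 d c x y = (\<Sum>i\<le>d. \<Sum>j\<le>d. c i j * x ^ i * y ^ j)"

definition has_irr_nonconst_coeff :: "nat \<Rightarrow> (nat \<Rightarrow> nat \<Rightarrow> real) \<Rightarrow> bool" where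
  "has_irr_nonconst_coeff d c \<longleftrightarrow> (\<exists>i\<le>d. \<exists>j\<le>d. (i, j) \<noteq> (0, 0) \<and> c i j \<notin> \<rat>)"

definition avg_tends_zero :: "(nat \<Rightarrow> complex) \<Rightarrow> bool" where
  "avg_tends_zero f \<longleftrightarrow> (\<forall>\<eta>>0. \<exists>L. \<forall>M N. M < N \<and> N - M \<ge> L \<longrightarrow>
      norm ((\<Sum>n\<in>{M<..N}. f n) / of_nat (N - M)) < \<eta>)"

definition ud_mod1_2 :: "(nat \<Rightarrow> real \<times> real) \<Rightarrow> bool" where
  "ud_mod1_2 x \<longleftrightarrow> (\<forall>a b c d. 0 \<le> a \<and> a < b \<and> b \<le> 1 \<and> 0 \<le> c \<and> c < d \<and> d \<le> 1 \<longrightarrow>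
     ((\<lambda>N. real (card {n\<in>{1..N}. frac (fst (x n)) \<in> {a<..<b} \<and> frac (snd (x n)) \<in> {c<..<d}}) / real N)
       \<longlonglongrightarrow> (b - a) * (d - c)))"

end

theory Submission
  imports Defs
begin

text \<open>
  Let \<open>q = card D\<close> and let \<open>\<kappa> n\<close> be the \<open>n\<close>-th element of the digit set, counted from 0. Writing \<open>n\<close> in base
  \<open>q\<close> and replacing each digit by the corresponding element of \<open>D\<close> gives
  \<open>\<kappa> (q ^ m * n + r) = b ^ m * \<kappa> n + \<kappa> r\<close> for \<open>r < q ^ m\<close>, and the digit sums add up likewise. Hence it
  suffices that the averages of \<open>e (P (u + \<kappa> r, v + s (\<kappa> r)))\<close> over \<open>r < q ^ m\<close> tend to 0 uniformly in
  the real translations \<open>u\<close> and \<open>v\<close>.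

  If \<open>P\<close> is linear, the average is a product over the digits, and its factors cannot tend to 1 unless both
  coefficients are rational. If the homogeneous part of top degree has an irrational coefficient, Cauchy--Schwarz
  applied to a fixed number of low digits replaces \<open>P\<close> by differences of smaller degree. Those without an
  irrational top coefficient come from pairs of digit strings on which a fixed integral linear form in
  \<open>(\<kappa>, s)\<close> agrees, and by the linear case such pairs have small density. In general, \<open>e\<close> of the
  part of \<open>P\<close> with rational coefficients is periodic, and expanding it in characters of a finite group perturbs the
  irrational part only by rational linear terms.

  Uniform distribution follows from Weyl's criterion: indicators of intervals are squeezed between trigonometric
  polynomials, which exist by Stone--Weierstrass on the unit circle.
\<close>

section \<open>Exponential sums over digit strings\<close>

lemma ee_eq_cis: "ee x = cis (2 * pi * x)"
  by (simp add: ee_def cis_conv_exp mult_ac)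

lemma norm_ee [simp]: "norm (ee x) = 1"
  by (simp add: ee_eq_cis)

lemma ee_0 [simp]: "ee 0 = 1"
  by (simp add: ee_eq_cis)

lemma ee_add: "ee (x + y) = ee x * ee y"
  by (simp add: ee_eq_cis cis_mult algebra_simps)

lemma ee_minus: "ee (- x) = cnj (ee x)"
  by (simp add: ee_eq_cis cis_cnj)

lemma ee_diff: "ee (x - y) = ee x * cnj (ee y)"
  using ee_add[of x "- y"] by (simp add: ee_minus)

lemma ee_of_int [simp]: "ee (of_int n) = 1"
  by (simp add: ee_eq_cis cis_multiple_2pi)

lemma ee_eq_1_iff: "ee x = 1 \<longleftrightarrow> x \<in> \<int>"
proof
  assume "ee x = 1"
  then have "cos (2 * pi * x) = 1"
    by (simp add: ee_eq_cis complex_eq_iff)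
  then obtain n :: int where "2 * pi * x = of_int n * 2 * pi"
    by (auto simp: cos_one_2pi_int)
  then have "x = of_int n" by simp
  then show "x \<in> \<int>" by simp
next
  assume "x \<in> \<int>"
  then show "ee x = 1" by (auto elim: Ints_cases)
qed

lemma ee_mult_nat: "ee (of_nat n * x) = ee x ^ n"
  unfolding ee_eq_cis Complex.DeMoivre by (simp add: mult_ac)

text \<open>Taking \<open>b\<close>-th powers expands distances near 1: the distance of
  \<open>z ^ b\<close> from 1 is that of \<open>z\<close> times the modulus of
  \<open>1 + z + ... + z ^ (b - 1)\<close>, which is close to \<open>b\<close>. An orbit of this map
  that tends to 1 must therefore reach 1 exactly, and then \<open>y * b ^ J\<close> is an
  integer.\<close>

lemma rational_of_tendsto_ee_power:
  fixes y :: real and b :: nat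
  assumes b: "b \<ge> 2" and lim: "(\<lambda>j. ee (y * of_nat b ^ j)) \<longlonglongrightarrow> 1"
  shows "y \<in> \<rat>"
proof -
  define z where "z j = ee (y * of_nat b ^ j)" for j
  have z_Suc: "z (Suc j) = z j ^ b" for j
    by (simp add: z_def mult_ac flip: ee_mult_nat)
  have z1: "z \<longlonglongrightarrow> 1" using lim by (simp add: z_def[abs_def])
  have "(\<lambda>j. norm (\<Sum>i<b. z j ^ i)) \<longlonglongrightarrow> norm (\<Sum>i<b. (1::complex) ^ i)"
    by (intro tendsto_intros z1)
  then have "(\<lambda>j. norm (\<Sum>i<b. z j ^ i)) \<longlonglongrightarrow> real b" by simp
  then have "\<forall>\<^sub>F j in sequentially. norm (\<Sum>i<b. z j ^ i) > 1"
    by (rule order_tendstoD) (use b in simp)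
  then obtain J where J: "\<And>j. j \<ge> J \<Longrightarrow> norm (\<Sum>i<b. z j ^ i) > 1"
    by (auto simp: eventually_sequentially)
  have step: "norm (z j - 1) \<le> norm (z (Suc j) - 1)" if "j \<ge> J" for j
  proof -
    have "norm (z (Suc j) - 1) = norm (z j - 1) * norm (\<Sum>i<b. z j ^ i)"
      by (simp add: z_Suc power_diff_1_eq norm_mult)
    then show ?thesis using J[OF that] by (simp add: mult_le_cancel_left1 less_imp_le)
  qed
  have mono: "norm (z J - 1) \<le> norm (z (J + k) - 1)" for k
  proof (induction k)
    case (Suc k)
    then show ?case using step[of "J + k"] by simp
  qed simp
  have "(\<lambda>k. norm (z (J + k) - 1)) \<longlonglongrightarrow> norm (1 - 1 :: complex)"
    by (intro tendsto_intros LIMSEQ_ignore_initial_segment[OF z1, of J, simplified add.commute[of _ J]])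
  then have "norm (z J - 1) \<le> 0"
    using LIMSEQ_le_const mono by fastforce
  then have "y * of_nat b ^ J \<in> \<int>" by (simp add: z_def ee_eq_1_iff)
  then have "y * of_nat b ^ J \<in> \<rat>" using Ints_subset_Rats by blast
  then have "y * of_nat b ^ J / of_nat b ^ J \<in> \<rat>" by (intro Rats_divide) auto
  then show ?thesis using b by simp
qed

text \<open>By the parallelogram law, the squared distances of a unit number from -1 and from 1 add
  up to 4.\<close>

lemma norm_one_plus_tendsto_2:
  fixes z :: "nat \<Rightarrow> complex"
  assumes unit: "\<And>j. norm (z j) = 1" and lim: "(\<lambda>j. norm (1 + z j)) \<longlonglongrightarrow> 2"
  shows "z \<longlonglongrightarrow> 1"
proof -
  have par: "(norm (1 + z j))\<^sup>2 + (norm (z j - 1))\<^sup>2 = 4" for j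
  proof -
    have "(Re (z j))\<^sup>2 + (Im (z j))\<^sup>2 = 1"
      using unit[of j] by (metis cmod_power2 one_power2)
    then show ?thesis by (simp add: cmod_power2) (simp add: power2_eq_square algebra_simps)
  qed
  have "norm (z j - 1) = sqrt (4 - (norm (1 + z j))\<^sup>2)" for j
    using par[of j] by (intro real_sqrt_unique[symmetric]) auto
  then have eq: "(\<lambda>j. norm (z j - 1)) = (\<lambda>j. sqrt (4 - (norm (1 + z j))\<^sup>2))" by auto
  have "(\<lambda>j. sqrt (4 - (norm (1 + z j))\<^sup>2)) \<longlonglongrightarrow> sqrt (4 - 2\<^sup>2)"
    by (intro tendsto_intros lim)
  then have "(\<lambda>j. norm (z j - 1)) \<longlonglongrightarrow> 0" by (simp add: eq)
  then show ?thesis using tendsto_norm_zero_iff LIM_zero_iff by blast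
qed

text \<open>The partial products decrease and stay above \<open>\<epsilon>\<close>, so they have a
  nonzero limit, and each factor is a quotient of consecutive partial products.\<close>

lemma prod_not_tendsto_0_imp_factor_tendsto_1:
  fixes f :: "nat \<Rightarrow> real"
  assumes f01: "\<And>j. 0 \<le> f j" "\<And>j. f j \<le> 1"
    and low: "\<epsilon> > 0" "\<And>m. \<epsilon> \<le> (\<Prod>j<m. f j)"
  shows "f \<longlonglongrightarrow> 1"
proof -
  define p where "p m = (\<Prod>j<m. f j)" for m
  have p_pos: "p m > 0" for m using low(1) low(2)[of m] by (simp add: p_def)
  have "decseq p"
  proof (rule decseq_SucI)
    show "p (Suc m) \<le> p m" for m
      using f01[of m] p_pos[of m] by (simp add: p_def mult_left_le)
  qed
  then obtain l where l: "p \<longlonglongrightarrow> l"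
    using decseq_convergent[OF \<open>decseq p\<close>, of \<epsilon>] low(2) p_def by metis
  have "l \<ge> \<epsilon>" by (rule LIMSEQ_le_const[OF l]) (use low in \<open>auto simp: p_def\<close>)
  then have l0: "l \<noteq> 0" using low by auto
  have "(\<lambda>m. p (Suc m) / p m) \<longlonglongrightarrow> l / l"
    by (intro tendsto_divide l0 l LIMSEQ_Suc)
  moreover have "p (Suc m) / p m = f m" for m
  proof -
    have "p (Suc m) = p m * f m" by (simp add: p_def)
    then show ?thesis using p_pos[of m] by simp
  qed
  ultimately show ?thesis using l0 by simp
qed

section \<open>Digit systems and uniform decay of their exponential sums\<close>

lemma sum_blocks:
  fixes f :: "nat \<Rightarrow> 'a::comm_monoid_add"
  shows "(\<Sum>n<H * k. f n) = (\<Sum>j<k. \<Sum>r<H. f (H * j + r))"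
proof -
  have "(\<Sum>n<H * k. f n) = (\<Sum>j<k. sum f {j * H..<j * H + H})"
    by (simp add: sum.nat_group mult.commute)
  also have "\<dots> = (\<Sum>j<k. \<Sum>r<H. f (H * j + r))"
  proof (rule sum.cong[OF refl])
    show "sum f {j * H..<j * H + H} = (\<Sum>r<H. f (H * j + r))" for j
      using sum.shift_bounds_nat_ivl[of f 0 "j * H" H]
      by (simp add: add_ac mult.commute atLeast0LessThan)
  qed
  finally show ?thesis .
qed

text \<open>Here \<open>q\<close> is the number of admissible digits, \<open>\<delta> r\<close> the
  \<open>r\<close>-th of them, \<open>\<kappa> n\<close> the integer obtained from the
  base-\<open>q\<close> digits of \<open>n\<close>, and \<open>\<sigma> n\<close> its digit sum. The
  two recursions describe appending a lowest digit.\<close>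

locale digit_system =
  fixes b q :: nat and \<delta> \<kappa> \<sigma> :: "nat \<Rightarrow> nat"
  assumes b_ge_2: "b \<ge> 2" and q_ge_2: "q \<ge> 2"
    and \<delta>_0: "\<delta> 0 = 0" and \<delta>_1: "\<delta> 1 \<noteq> 0"
    and \<kappa>_0: "\<kappa> 0 = 0" and \<sigma>_0: "\<sigma> 0 = 0"
    and \<kappa>_rec: "r < q \<Longrightarrow> \<kappa> (q * n + r) = b * \<kappa> n + \<delta> r"
    and \<sigma>_rec: "r < q \<Longrightarrow> \<sigma> (q * n + r) = \<sigma> n + \<delta> r"
begin

lemma \<kappa>_digit: "r < q \<Longrightarrow> \<kappa> r = \<delta> r"
  using \<kappa>_rec[of r 0] by (simp add: \<kappa>_0)

lemma \<sigma>_digit: "r < q \<Longrightarrow> \<sigma> r = \<delta> r"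
  using \<sigma>_rec[of r 0] by (simp add: \<sigma>_0)

text \<open>The base-\<open>q\<close> string of \<open>q ^ m * n + r\<close> is that of
  \<open>n\<close> followed by \<open>m\<close> digits for \<open>r\<close>. The induction strips
  the lowest digit, which both numbers share.\<close>

lemma \<kappa>_\<sigma>_concat:
  "r < q ^ m \<Longrightarrow> \<kappa> (q ^ m * n + r) = b ^ m * \<kappa> n + \<kappa> r \<and> \<sigma> (q ^ m * n + r) = \<sigma> n + \<sigma> r"
proof (induction m arbitrary: r)
  case 0
  then show ?case by (simp add: \<kappa>_0 \<sigma>_0)
next
  case (Suc m)
  define r1 r0 where "r1 = r div q" and "r0 = r mod q"
  have r: "r = q * r1 + r0" and r0: "r0 < q"
    using q_ge_2 by (simp_all add: r1_def r0_def)
  have r1: "r1 < q ^ m"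
    using Suc.prems q_ge_2 by (simp add: r1_def less_mult_imp_div_less mult.commute)
  have "q ^ Suc m * n + r = q * (q ^ m * n + r1) + r0"
    by (simp add: r algebra_simps)
  then have "\<kappa> (q ^ Suc m * n + r) = b * \<kappa> (q ^ m * n + r1) + \<delta> r0"
    "\<sigma> (q ^ Suc m * n + r) = \<sigma> (q ^ m * n + r1) + \<delta> r0"
    by (simp_all only: \<kappa>_rec[OF r0] \<sigma>_rec[OF r0])
  moreover have "\<kappa> r = b * \<kappa> r1 + \<delta> r0" "\<sigma> r = \<sigma> r1 + \<delta> r0"
    by (simp_all only: r \<kappa>_rec[OF r0] \<sigma>_rec[OF r0])
  ultimately show ?case using Suc.IH[OF r1] by (simp add: algebra_simps)
qed

lemma \<kappa>_concat: "r < q ^ m \<Longrightarrow> \<kappa> (q ^ m * n + r) = b ^ m * \<kappa> n + \<kappa> r"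
  and \<sigma>_concat: "r < q ^ m \<Longrightarrow> \<sigma> (q ^ m * n + r) = \<sigma> n + \<sigma> r"
  using \<kappa>_\<sigma>_concat by blast+

definition esum :: "(real \<Rightarrow> real \<Rightarrow> real) \<Rightarrow> nat \<Rightarrow> real \<Rightarrow> real \<Rightarrow> complex" where
  "esum P m u v = (\<Sum>n<q ^ m. ee (P (u + real (\<kappa> n)) (v + real (\<sigma> n))))"

text \<open>The translations are real and the bound is uniform in them. Higher digits act as
  translations, and differencing rescales the first variable by a power of \<open>b\<close>, so a
  translation has to be divided by that power.\<close>

definition decays :: "(real \<Rightarrow> real \<Rightarrow> real) \<Rightarrow> bool" where
  "decays P \<longleftrightarrow> (\<forall>\<epsilon>>0. \<exists>m0. \<forall>m\<ge>m0. \<forall>u v. norm (esum P m u v) \<le> \<epsilon> * real q ^ m)"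

lemma esum_concat:
  "esum P (m + k) u v = (\<Sum>n<q ^ k. esum P m (u + real (b ^ m * \<kappa> n)) (v + real (\<sigma> n)))"
  unfolding esum_def power_add sum_blocks
  by (intro sum.cong refl) (simp add: \<kappa>_concat \<sigma>_concat add.assoc)

lemma norm_esum_le: "norm (esum P m u v) \<le> real q ^ m"
  unfolding esum_def by (rule order.trans[OF norm_sum]) simp

text \<open>Each choice of the \<open>k\<close> leading digits leaves a translated sum of length
  \<open>m\<close>, to which the uniform bound applies. Hence \<open>decays\<close> only has to be
  checked at one length for each \<open>\<epsilon>\<close>.\<close>

lemma esum_bound_mono:
  assumes "\<And>u v. norm (esum P m u v) \<le> \<epsilon> * real q ^ m"
  shows "norm (esum P (m + k) u v) \<le> \<epsilon> * real q ^ (m + k)"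
proof -
  have "norm (esum P (m + k) u v) \<le> (\<Sum>n<q ^ k. \<epsilon> * real q ^ m)"
    unfolding esum_concat by (rule sum_norm_le) (rule assms)
  then show ?thesis by (simp add: power_add mult_ac)
qed

lemma decaysI:
  assumes "\<And>\<epsilon>. \<epsilon> > 0 \<Longrightarrow> \<exists>m. \<forall>u v. norm (esum P m u v) \<le> \<epsilon> * real q ^ m"
  shows "decays P"
  unfolding decays_def
proof (intro allI impI)
  fix \<epsilon> :: real assume "\<epsilon> > 0"
  with assms obtain m where "\<And>u v. norm (esum P m u v) \<le> \<epsilon> * real q ^ m" by blast
  from esum_bound_mono[OF this] have "\<forall>m'\<ge>m. \<forall>u v. norm (esum P m' u v) \<le> \<epsilon> * real q ^ m'"
    by (metis le_Suc_ex)
  then show "\<exists>m0. \<forall>m\<ge>m0. \<forall>u v. norm (esum P m u v) \<le> \<epsilon> * real q ^ m" by blast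
qed

lemma decays_uniform:
  assumes "finite I" "\<And>i. i \<in> I \<Longrightarrow> decays (P i)" "\<epsilon> > 0"
  shows "\<exists>m0. \<forall>m\<ge>m0. \<forall>i\<in>I. \<forall>u v. norm (esum (P i) m u v) \<le> \<epsilon> * real q ^ m"
proof -
  have "\<forall>\<^sub>F m in sequentially. \<forall>i\<in>I. \<forall>u v. norm (esum (P i) m u v) \<le> \<epsilon> * real q ^ m"
    using assms by (intro eventually_ball_finite)
      (auto simp: decays_def eventually_sequentially)
  then show ?thesis by (simp add: eventually_sequentially)
qed

text \<open>A linear phase is additive over the digits: digit \<open>r\<close> at position
  \<open>j\<close> contributes \<open>(A * b ^ j + B) * \<delta> r\<close>. The translations and
  \<open>C\<close> only change a factor of modulus 1.\<close>

lemma norm_esum_linear: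
  "norm (esum (\<lambda>x y. A * x + B * y + C) m u v)
    = (\<Prod>j<m. norm (\<Sum>r<q. ee ((A * real b ^ j + B) * real (\<delta> r))))"
proof (induction m arbitrary: u v)
  case 0
  then show ?case by (simp add: esum_def)
next
  case (Suc m)
  let ?P = "\<lambda>x y. A * x + B * y + C"
  have "esum ?P (m + 1) u v
      = (\<Sum>r<q. esum ?P m u v * ee ((A * real b ^ m + B) * real (\<delta> r)))"
    unfolding esum_concat
  proof (intro sum.cong)
    fix r assume "r \<in> {..<q}"
    then have "\<kappa> r = \<delta> r" "\<sigma> r = \<delta> r" by (auto simp: \<kappa>_digit \<sigma>_digit)
    then show "esum ?P m (u + real (b ^ m * \<kappa> r)) (v + real (\<sigma> r))
        = esum ?P m u v * ee ((A * real b ^ m + B) * real (\<delta> r))"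
      unfolding esum_def sum_distrib_right ee_add[symmetric]
      by (intro sum.cong refl arg_cong[of _ _ ee]) (simp add: algebra_simps)
  qed simp
  also have "\<dots> = esum ?P m u v * (\<Sum>r<q. ee ((A * real b ^ m + B) * real (\<delta> r)))"
    by (simp add: sum_distrib_left)
  finally show ?case using Suc.IH by (simp add: norm_mult)
qed

text \<open>Without decay the normalized factors of the product tend to 1, so the terms for the two
  digits \<open>\<delta> 0 = 0\<close> and \<open>\<delta> 1\<close> become aligned, which forces
  both coefficients to be rational.\<close>

lemma decays_linear:
  assumes irr: "A \<notin> \<rat> \<or> B \<notin> \<rat>"
  shows "decays (\<lambda>x y. A * x + B * y + C)"
proof (rule ccontr)
  let ?P = "\<lambda>x y. A * x + B * y + C"
  define f where "f j = norm (\<Sum>r<q. ee ((A * real b ^ j + B) * real (\<delta> r))) / real q" for j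
  have prod_f: "(\<Prod>j<m. f j) = norm (esum ?P m u v) / real q ^ m" for m u v
    unfolding norm_esum_linear f_def by (simp add: prod_dividef)
  assume "\<not> decays ?P"
  then obtain \<epsilon> where eps: "\<epsilon> > 0" "\<And>m. \<exists>u v. \<epsilon> * real q ^ m < norm (esum ?P m u v)"
    using decaysI[of ?P] by (metis not_le)
  have q0: "real q > 0" using q_ge_2 by simp
  have f_lim: "f \<longlonglongrightarrow> 1"
  proof (rule prod_not_tendsto_0_imp_factor_tendsto_1[OF _ _ eps(1)])
    show "0 \<le> f j" for j by (simp add: f_def)
    show "f j \<le> 1" for j
    proof -
      have "norm (\<Sum>r<q. ee ((A * real b ^ j + B) * real (\<delta> r))) \<le> real q"
        by (rule order.trans[OF norm_sum]) simp
      then show ?thesis using q0 by (simp add: f_def)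
    qed
    show "\<epsilon> \<le> (\<Prod>j<m. f j)" for m
    proof -
      obtain u v where "\<epsilon> * real q ^ m < norm (esum ?P m u v)" using eps(2) by blast
      then show ?thesis unfolding prod_f[of m u v] using q0 by (simp add: field_simps)
    qed
  qed
  define x where "x j = (A * real b ^ j + B) * real (\<delta> 1)" for j
  have "(\<lambda>j. norm (1 + ee (x j))) \<longlonglongrightarrow> 2"
  proof (rule real_tendsto_sandwich)
    show "\<forall>\<^sub>F j in sequentially. real q * f j - (real q - 2) \<le> norm (1 + ee (x j))"
    proof (intro always_eventually allI)
      fix j
      let ?g = "\<lambda>r. ee ((A * real b ^ j + B) * real (\<delta> r))"
      \<comment> \<open>Digit 0 contributes 1 and digit 1 contributes \<open>ee (x j)\<close>; the
        remaining \<open>q - 2\<close> terms have modulus 1, so the first two must nearly reach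
        modulus 2.\<close>
      have "{..<q} = insert 0 (insert 1 {2..<q})" using q_ge_2 by auto
      then have "(\<Sum>r<q. ?g r) = ?g 0 + (?g 1 + (\<Sum>r\<in>{2..<q}. ?g r))" by simp
      then have split: "(\<Sum>r<q. ?g r) = (1 + ee (x j)) + (\<Sum>r\<in>{2..<q}. ?g r)"
        by (simp add: \<delta>_0 x_def add.assoc)
      have "norm (\<Sum>r\<in>{2..<q}. ?g r) \<le> real (q - 2)"
        by (rule order.trans[OF norm_sum]) simp
      then have "norm (\<Sum>r<q. ?g r) \<le> norm (1 + ee (x j)) + (real q - 2)"
        unfolding split using q_ge_2 by (intro norm_triangle_le) (simp add: of_nat_diff)
      then show "real q * f j - (real q - 2) \<le> norm (1 + ee (x j))"
        using q0 by (simp add: f_def)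
    qed
    show "\<forall>\<^sub>F j in sequentially. norm (1 + ee (x j)) \<le> 2"
      by (intro always_eventually allI norm_triangle_le) simp
    have "(\<lambda>j. real q * f j - (real q - 2)) \<longlonglongrightarrow> real q * 1 - (real q - 2)"
      by (intro tendsto_intros f_lim)
    then show "(\<lambda>j. real q * f j - (real q - 2)) \<longlonglongrightarrow> 2" by simp
  qed simp
  then have lim: "(\<lambda>j. ee (x j)) \<longlonglongrightarrow> 1"
    by (intro norm_one_plus_tendsto_2) simp_all
  \<comment> \<open>The combination \<open>x (Suc j) - b * x j\<close> eliminates \<open>A\<close>
    and equals the constant \<open>w\<close>.\<close>
  define w where "w = B * real (\<delta> 1) * (1 - real b)"
  have "(\<lambda>j. ee (x (Suc j)) * cnj (ee (x j) ^ b)) \<longlonglongrightarrow> 1 * cnj (1 ^ b)"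
    by (intro tendsto_intros lim LIMSEQ_Suc)
  moreover have "ee (x (Suc j)) * cnj (ee (x j) ^ b) = ee w" for j
    unfolding ee_mult_nat[symmetric] ee_diff[symmetric]
    by (simp add: w_def x_def algebra_simps)
  ultimately have "ee w = 1" by (simp add: LIMSEQ_const_iff)
  then have "w \<in> \<rat>" using ee_eq_1_iff Ints_subset_Rats by blast
  then have "w / (real (\<delta> 1) * (1 - real b)) \<in> \<rat>"
    by (intro Rats_divide Rats_mult Rats_diff) auto
  then have B: "B \<in> \<rat>" using \<delta>_1 b_ge_2 by (simp add: w_def)
  \<comment> \<open>The difference \<open>x (Suc j) - x j\<close> eliminates \<open>B\<close> and
    equals \<open>y * b ^ j\<close>.\<close>
  define y where "y = A * (real b - 1) * real (\<delta> 1)"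
  have "(\<lambda>j. ee (x (Suc j)) * cnj (ee (x j))) \<longlonglongrightarrow> 1 * cnj 1"
    by (intro tendsto_intros lim LIMSEQ_Suc)
  moreover have "ee (x (Suc j)) * cnj (ee (x j)) = ee (y * real b ^ j)" for j
    unfolding ee_diff[symmetric] by (simp add: y_def x_def algebra_simps)
  ultimately have "y \<in> \<rat>"
    using rational_of_tendsto_ee_power[OF b_ge_2, of y] by simp
  then have "y / ((real b - 1) * real (\<delta> 1)) \<in> \<rat>"
    by (intro Rats_divide Rats_mult Rats_diff) auto
  then have "A \<in> \<rat>" using \<delta>_1 b_ge_2 by (simp add: y_def)
  with B irr show False by blast
qed

text \<open>For irrational \<open>\<theta>\<close>, the kernel \<open>\<bar>\<Sum>t<T. e (t * \<theta> * x)\<bar>\<^sup>2\<close> is nonnegative and equals \<open>T\<^sup>2\<close> at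
  \<open>x = 0\<close>, so its sum over all pairs bounds the number of collisions; expanding the square leaves only
  exponential sums with linear phases.\<close>

lemma collisions_rare:
  fixes a c :: int
  assumes ac: "(a, c) \<noteq> (0, 0)" and eps: "\<epsilon> > 0"
  shows "\<exists>m. real (card {(r, s) \<in> {..<q ^ m} \<times> {..<q ^ m}.
            a * int (\<kappa> r) + c * int (\<sigma> r) = a * int (\<kappa> s) + c * int (\<sigma> s)})
          \<le> \<epsilon> * (real q ^ m)\<^sup>2"
proof -
  have "uncountable (UNIV - \<rat> :: real set)"
    by (intro uncountable_minus_countable uncountable_UNIV_real countable_rat)
  then obtain \<theta> :: real where \<theta>: "\<theta> \<notin> \<rat>"
    by (metis DiffE countable_empty ex_in_conv)
  have \<theta>_mult: "of_int k * \<theta> \<notin> \<rat>" if "k \<noteq> 0" for k :: int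
  proof
    assume "of_int k * \<theta> \<in> \<rat>"
    then have "of_int k * \<theta> / of_int k \<in> \<rat>" by (intro Rats_divide) auto
    with \<theta> that show False by simp
  qed
  \<comment> \<open>With \<open>T > 2 / \<epsilon>\<close> the \<open>T\<close> diagonal pairs
    \<open>t = t'\<close> account for at most half of the final bound. The off-diagonal pairs supply
    the other half; their tolerance \<open>sqrt (\<epsilon> / 2)\<close> is a square root because
    their norms enter squared.\<close>
  obtain T :: nat where T: "real T > 2 / \<epsilon>" using reals_Archimedean2 by blast
  then have T0: "T > 0" using eps by (metis divide_pos_pos less_asym of_nat_0 zero_less_numeral gr0I)
  define G where "G r = of_int a * real (\<kappa> r) + of_int c * real (\<sigma> r)" for r
  define L :: "nat \<times> nat \<Rightarrow> real \<Rightarrow> real \<Rightarrow> real" where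
    "L = (\<lambda>(t, t') x y. (of_int (int t - int t') * \<theta> * of_int a) * x
                        + (of_int (int t - int t') * \<theta> * of_int c) * y + 0)"
  let ?I = "{p \<in> {..<T} \<times> {..<T}. fst p \<noteq> snd p}"
  have "\<exists>m0. \<forall>m\<ge>m0. \<forall>i\<in>?I. \<forall>u v. norm (esum (L i) m u v) \<le> sqrt (\<epsilon> / 2) * real q ^ m"
  proof (rule decays_uniform)
    fix p assume "p \<in> ?I"
    then obtain t t' where p: "p = (t, t')" and ne: "t \<noteq> t'" by (cases p) auto
    from ac have "of_int ((int t - int t') * a) * \<theta> \<notin> \<rat> \<or> of_int ((int t - int t') * c) * \<theta> \<notin> \<rat>"
      using \<theta>_mult[of "(int t - int t') * a"] \<theta>_mult[of "(int t - int t') * c"] ne by auto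
    then show "decays (L p)"
      unfolding L_def p case_prod_conv by (intro decays_linear) (simp add: mult_ac)
  qed (use eps in auto)
  then obtain m where m: "\<And>i. i \<in> ?I \<Longrightarrow> norm (esum (L i) m 0 0) \<le> sqrt (\<epsilon> / 2) * real q ^ m"
    by blast
  let ?R = "{..<q ^ m}"
  let ?B = "{(r, s) \<in> ?R \<times> ?R. a * int (\<kappa> r) + c * int (\<sigma> r) = a * int (\<kappa> s) + c * int (\<sigma> s)}"
  have esum_L: "esum (L (t, t')) m 0 0 = (\<Sum>r\<in>?R. ee ((real t - real t') * \<theta> * G r))" for t t'
    by (simp add: esum_def L_def G_def algebra_simps)
  define F where "F r s t t' = ee ((real t - real t') * \<theta> * (G r - G s))" for r s t t'
  have F_sq: "complex_of_real ((norm (\<Sum>t<T. ee (real t * \<theta> * (G r - G s))))\<^sup>2)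
      = (\<Sum>(t, t')\<in>{..<T} \<times> {..<T}. F r s t t')" for r s
  proof -
    have "F r s t t' = ee (real t * \<theta> * (G r - G s)) * cnj (ee (real t' * \<theta> * (G r - G s)))" for t t'
      unfolding F_def ee_diff[symmetric] by (simp add: algebra_simps)
    then show ?thesis
      by (simp only: complex_norm_square cnj_sum sum_product sum.cartesian_product)
  qed
  \<comment> \<open>Summing over \<open>r\<close> and \<open>s\<close> first turns each pair
    \<open>(t, t')\<close> into the squared modulus of the exponential sum with phase
    \<open>L (t, t')\<close>.\<close>
  have "complex_of_real (\<Sum>(r, s)\<in>?R \<times> ?R. (norm (\<Sum>t<T. ee (real t * \<theta> * (G r - G s))))\<^sup>2)
      = (\<Sum>(r, s)\<in>?R \<times> ?R. \<Sum>(t, t')\<in>{..<T} \<times> {..<T}. F r s t t')"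
    unfolding of_real_sum case_prod_unfold F_sq[unfolded case_prod_unfold] ..
  also have "\<dots> = (\<Sum>(t, t')\<in>{..<T} \<times> {..<T}. \<Sum>(r, s)\<in>?R \<times> ?R. F r s t t')"
    unfolding case_prod_unfold by (rule sum.swap)
  also have "\<dots> = (\<Sum>p\<in>{..<T} \<times> {..<T}. complex_of_real ((norm (esum (L p) m 0 0))\<^sup>2))"
  proof (intro sum.cong refl)
    fix p assume "p \<in> {..<T} \<times> {..<T}"
    obtain t t' where p: "p = (t, t')" by (cases p)
    have "F r s t t' = ee ((real t - real t') * \<theta> * G r) * cnj (ee ((real t - real t') * \<theta> * G s))" for r s
      unfolding F_def ee_diff[symmetric] by (simp add: algebra_simps)
    then show "(case p of (t, t') \<Rightarrow> \<Sum>(r, s)\<in>?R \<times> ?R. F r s t t')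
        = complex_of_real ((norm (esum (L p) m 0 0))\<^sup>2)"
      unfolding p case_prod_conv complex_norm_square esum_L
      by (simp add: sum_product flip: sum.cartesian_product)
  qed
  finally have "complex_of_real (\<Sum>(r, s)\<in>?R \<times> ?R. (norm (\<Sum>t<T. ee (real t * \<theta> * (G r - G s))))\<^sup>2)
      = complex_of_real (\<Sum>p\<in>{..<T} \<times> {..<T}. (norm (esum (L p) m 0 0))\<^sup>2)"
    by simp
  then have fejer: "(\<Sum>(r, s)\<in>?R \<times> ?R. (norm (\<Sum>t<T. ee (real t * \<theta> * (G r - G s))))\<^sup>2)
      = (\<Sum>p\<in>{..<T} \<times> {..<T}. (norm (esum (L p) m 0 0))\<^sup>2)"
    by (simp only: of_real_eq_iff)
  have "real (card ?B) * (real T)\<^sup>2 = (\<Sum>(r, s)\<in>?B. (real T)\<^sup>2)"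
    by (simp add: case_prod_unfold)
  also have "\<dots> = (\<Sum>(r, s)\<in>?B. (norm (\<Sum>t<T. ee (real t * \<theta> * (G r - G s))))\<^sup>2)"
  proof (intro sum.cong refl)
    fix p assume "p \<in> ?B"
    then obtain r s where p: "p = (r, s)"
      and eq: "a * int (\<kappa> r) + c * int (\<sigma> r) = a * int (\<kappa> s) + c * int (\<sigma> s)" by auto
    have "G r = of_int (a * int (\<kappa> r) + c * int (\<sigma> r))"
      "G s = of_int (a * int (\<kappa> s) + c * int (\<sigma> s))" by (simp_all add: G_def)
    then show "(case p of (r, s) \<Rightarrow> (real T)\<^sup>2)
        = (case p of (r, s) \<Rightarrow> (norm (\<Sum>t<T. ee (real t * \<theta> * (G r - G s))))\<^sup>2)"
      by (simp add: p eq)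
  qed
  also have "\<dots> \<le> (\<Sum>(r, s)\<in>?R \<times> ?R. (norm (\<Sum>t<T. ee (real t * \<theta> * (G r - G s))))\<^sup>2)"
    by (intro sum_mono2) auto
  also have "\<dots> = (\<Sum>p\<in>?I. (norm (esum (L p) m 0 0))\<^sup>2)
      + (\<Sum>p\<in>{..<T} \<times> {..<T} - ?I. (norm (esum (L p) m 0 0))\<^sup>2)"
    unfolding fejer by (subst sum.subset_diff[of ?I]) auto
  also have "\<dots> \<le> (\<Sum>p\<in>?I. (sqrt (\<epsilon> / 2) * real q ^ m)\<^sup>2)
      + (\<Sum>p\<in>{..<T} \<times> {..<T} - ?I. (real q ^ m)\<^sup>2)"
    by (intro add_mono sum_mono power_mono m norm_esum_le) auto
  also have "\<dots> \<le> (real T)\<^sup>2 * (\<epsilon> / 2 * (real q ^ m)\<^sup>2) + real T * (real q ^ m)\<^sup>2"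
  proof (intro add_mono)
    have "card ?I \<le> card ({..<T} \<times> {..<T})" by (rule card_mono) auto
    then have "real (card ?I) \<le> real (T * T)" by (simp only: of_nat_le_iff) simp
    then show "(\<Sum>p\<in>?I. (sqrt (\<epsilon> / 2) * real q ^ m)\<^sup>2) \<le> (real T)\<^sup>2 * (\<epsilon> / 2 * (real q ^ m)\<^sup>2)"
      using eps mult_right_mono[of "real (card ?I)" "real (T * T)" "\<epsilon> / 2 * (real q ^ m)\<^sup>2"]
      by (simp add: power_mult_distrib power2_eq_square[of "real T"])
    have "{..<T} \<times> {..<T} - ?I = (\<lambda>t. (t, t)) ` {..<T}" by auto
    then have "card ({..<T} \<times> {..<T} - ?I) = T" by (simp add: card_image inj_on_def)
    then show "(\<Sum>p\<in>{..<T} \<times> {..<T} - ?I. (real q ^ m)\<^sup>2) \<le> real T * (real q ^ m)\<^sup>2" by simp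
  qed
  also have "\<dots> \<le> (\<epsilon> * (real q ^ m)\<^sup>2) * (real T)\<^sup>2"
  proof -
    have "1 \<le> \<epsilon> / 2 * real T" using T eps by (simp add: field_simps)
    then have "real T * 1 \<le> real T * (\<epsilon> / 2 * real T)" by (intro mult_left_mono) auto
    then have "real T * (real q ^ m)\<^sup>2 \<le> \<epsilon> / 2 * (real T)\<^sup>2 * (real q ^ m)\<^sup>2"
      by (intro mult_right_mono) (simp_all add: power2_eq_square mult_ac)
    then show ?thesis by (simp add: field_simps)
  qed
  finally have "real (card ?B) \<le> \<epsilon> * (real q ^ m)\<^sup>2"
    using T0 by (simp add: mult_le_cancel_right)
  then show ?thesis by blast
qed

text \<open>Van der Corput differencing in the \<open>m\<close> lowest digits.\<close>

lemma decays_of_differences: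
  fixes a c :: int
  assumes ac: "(a, c) \<noteq> (0, 0)"
    and diff: "\<And>m r s. a * int (\<kappa> r) + c * int (\<sigma> r) \<noteq> a * int (\<kappa> s) + c * int (\<sigma> s) \<Longrightarrow>
      decays (\<lambda>x y. P (real b ^ m * x + real (\<kappa> r)) (y + real (\<sigma> r))
                    - P (real b ^ m * x + real (\<kappa> s)) (y + real (\<sigma> s)))"
  shows "decays P"
proof (rule decaysI)
  \<comment> \<open>After squaring, the target is \<open>\<epsilon>\<close> squared, half for
    colliding pairs of low strings and half for the others. The low length \<open>k\<close> is fixed
    by the collisions; only then is the high length \<open>m\<close> chosen, uniformly over the
    finitely many other pairs.\<close>
  fix \<epsilon> :: real assume eps: "\<epsilon> > 0"
  then have eps2: "\<epsilon>\<^sup>2 / 2 > 0" by simp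
  from collisions_rare[OF ac eps2] obtain k where
    k: "real (card {(r, s) \<in> {..<q ^ k} \<times> {..<q ^ k}.
            a * int (\<kappa> r) + c * int (\<sigma> r) = a * int (\<kappa> s) + c * int (\<sigma> s)})
          \<le> \<epsilon>\<^sup>2 / 2 * (real q ^ k)\<^sup>2" by blast
  let ?R = "{..<q ^ k}"
  define B where "B = {(r, s) \<in> ?R \<times> ?R. a * int (\<kappa> r) + c * int (\<sigma> r) = a * int (\<kappa> s) + c * int (\<sigma> s)}"
  define Q where "Q = (\<lambda>(r, s) x y. P (real b ^ k * x + real (\<kappa> r)) (y + real (\<sigma> r))
                    - P (real b ^ k * x + real (\<kappa> s)) (y + real (\<sigma> s)))"
  have B_sub: "B \<subseteq> ?R \<times> ?R" by (auto simp: B_def)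
  have "\<exists>m0. \<forall>m\<ge>m0. \<forall>i\<in>?R \<times> ?R - B. \<forall>u v. norm (esum (Q i) m u v) \<le> \<epsilon>\<^sup>2 / 2 * real q ^ m"
    by (rule decays_uniform[OF _ _ eps2]) (auto simp: B_def Q_def intro: diff)
  then obtain m where m: "\<And>i u v. i \<in> ?R \<times> ?R - B \<Longrightarrow> norm (esum (Q i) m u v) \<le> \<epsilon>\<^sup>2 / 2 * real q ^ m"
    by blast
  have "norm (esum P (k + m) u v) \<le> \<epsilon> * real q ^ (k + m)" for u v
  proof -
    \<comment> \<open>Writing \<open>u\<close> as \<open>b ^ k * u'\<close> puts the translation
      inside the rescaled variable, where the uniform bound for the differences \<open>Q\<close>
      applies at \<open>u'\<close>.\<close>
    define u' where "u' = u / real b ^ k"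
    have u: "u = real b ^ k * u'" using b_ge_2 by (simp add: u'_def)
    define F where "F n r = ee (P (real b ^ k * (u' + real (\<kappa> n)) + real (\<kappa> r))
                                  (v + real (\<sigma> n) + real (\<sigma> r)))" for n r
    have "esum P (k + m) u v = (\<Sum>n<q ^ m. \<Sum>r\<in>?R. F n r)"
      unfolding esum_concat by (simp add: esum_def F_def u algebra_simps)
    then have "norm (esum P (k + m) u v) \<le> (\<Sum>n<q ^ m. norm (\<Sum>r\<in>?R. F n r))"
      by (simp add: norm_sum)
    then have "(norm (esum P (k + m) u v))\<^sup>2 \<le> (\<Sum>n<q ^ m. norm (\<Sum>r\<in>?R. F n r))\<^sup>2"
      by (intro power_mono) auto
    \<comment> \<open>Cauchy--Schwarz over the high strings \<open>n\<close>; expanding the square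
      over pairs of low strings then produces the difference phases.\<close>
    also have "\<dots> \<le> (\<Sum>n<q ^ m. (norm (\<Sum>r\<in>?R. F n r))\<^sup>2) * real q ^ m"
      using sum_squared_le_sum_of_squares[of "\<lambda>n. norm (\<Sum>r\<in>?R. F n r)" "{..<q ^ m}"] by simp
    finally have CS: "(norm (esum P (k + m) u v))\<^sup>2 \<le> (\<Sum>n<q ^ m. (norm (\<Sum>r\<in>?R. F n r))\<^sup>2) * real q ^ m" .
    have "complex_of_real (\<Sum>n<q ^ m. (norm (\<Sum>r\<in>?R. F n r))\<^sup>2)
        = (\<Sum>n<q ^ m. \<Sum>(r, s)\<in>?R \<times> ?R. F n r * cnj (F n s))"
      by (simp add: complex_norm_square sum_product flip: sum.cartesian_product del: of_real_power)
    also have "\<dots> = (\<Sum>(r, s)\<in>?R \<times> ?R. \<Sum>n<q ^ m. F n r * cnj (F n s))"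
      unfolding case_prod_unfold by (rule sum.swap)
    also have "\<dots> = (\<Sum>p\<in>?R \<times> ?R. esum (Q p) m u' v)"
      by (intro sum.cong refl) (auto simp: esum_def Q_def F_def ee_diff)
    finally have sq: "complex_of_real (\<Sum>n<q ^ m. (norm (\<Sum>r\<in>?R. F n r))\<^sup>2)
        = (\<Sum>p\<in>?R \<times> ?R. esum (Q p) m u' v)" .
    have "(\<Sum>n<q ^ m. (norm (\<Sum>r\<in>?R. F n r))\<^sup>2) = norm (\<Sum>p\<in>?R \<times> ?R. esum (Q p) m u' v)"
      unfolding sq[symmetric] norm_of_real by (simp add: sum_nonneg)
    also have "\<dots> \<le> (\<Sum>p\<in>?R \<times> ?R. norm (esum (Q p) m u' v))" by (rule norm_sum)
    also have "\<dots> = (\<Sum>p\<in>?R \<times> ?R - B. norm (esum (Q p) m u' v)) + (\<Sum>p\<in>B. norm (esum (Q p) m u' v))"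
      by (rule sum.subset_diff[OF B_sub]) simp
    also have "\<dots> \<le> (\<Sum>p\<in>?R \<times> ?R - B. \<epsilon>\<^sup>2 / 2 * real q ^ m) + (\<Sum>p\<in>B. real q ^ m)"
      by (intro add_mono sum_mono m norm_esum_le)
    also have "\<dots> \<le> (\<Sum>p\<in>?R \<times> ?R. \<epsilon>\<^sup>2 / 2 * real q ^ m) + \<epsilon>\<^sup>2 / 2 * (real q ^ k)\<^sup>2 * real q ^ m"
    proof (intro add_mono)
      show "(\<Sum>p\<in>?R \<times> ?R - B. \<epsilon>\<^sup>2 / 2 * real q ^ m) \<le> (\<Sum>p\<in>?R \<times> ?R. \<epsilon>\<^sup>2 / 2 * real q ^ m)"
        by (intro sum_mono2) auto
      show "(\<Sum>p\<in>B. real q ^ m) \<le> \<epsilon>\<^sup>2 / 2 * (real q ^ k)\<^sup>2 * real q ^ m"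
        using mult_right_mono[OF k, of "real q ^ m"] unfolding B_def[symmetric] by simp
    qed
    also have "\<dots> = \<epsilon>\<^sup>2 * (real q ^ k)\<^sup>2 * real q ^ m"
      by (simp add: power2_eq_square)
    finally have diag: "(\<Sum>n<q ^ m. (norm (\<Sum>r\<in>?R. F n r))\<^sup>2) * real q ^ m
        \<le> \<epsilon>\<^sup>2 * (real q ^ k)\<^sup>2 * real q ^ m * real q ^ m"
      by (rule mult_right_mono) simp
    note CS
    also note diag
    also have "\<dots> = (\<epsilon> * real q ^ (k + m))\<^sup>2"
      by (simp add: power2_eq_square power_add)
    finally show ?thesis using eps by (simp add: power2_le_iff_abs_le)
  qed
  then show "\<exists>m. \<forall>u v. norm (esum P m u v) \<le> \<epsilon> * real q ^ m" by blast
qed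

end

section \<open>Differencing polynomials in two variables\<close>

text \<open>Polynomial functions of total degree strictly less than \<open>d\<close>. The strict
  bound lets degree drops end at \<open>polylt 0\<close>, which holds only for the zero
  function.\<close>

inductive polylt :: "nat \<Rightarrow> (real \<Rightarrow> real \<Rightarrow> real) \<Rightarrow> bool" for d where
  zero: "polylt d (\<lambda>x y. 0)"
| monom: "i + j < d \<Longrightarrow> polylt d (\<lambda>x y. c * x ^ i * y ^ j)"
| add: "polylt d P \<Longrightarrow> polylt d Q \<Longrightarrow> polylt d (\<lambda>x y. P x y + Q x y)"

lemma polylt_mono: "polylt d P \<Longrightarrow> d \<le> e \<Longrightarrow> polylt e P"
  by (induction rule: polylt.induct) (auto intro: polylt.intros)

lemma polylt_cmult: "polylt d P \<Longrightarrow> polylt d (\<lambda>x y. k * P x y)"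
proof (induction rule: polylt.induct)
  case (monom i j c)
  then show ?case using polylt.monom[of i j d "k * c"] by (simp add: mult_ac)
qed (auto simp: distrib_left intro: polylt.intros)

lemma polylt_diff: "polylt d P \<Longrightarrow> polylt d Q \<Longrightarrow> polylt d (\<lambda>x y. P x y - Q x y)"
  using polylt.add[OF _ polylt_cmult[of d Q "-1"], of P] by simp

lemma polylt_sum: "(\<And>i. i \<in> I \<Longrightarrow> polylt d (P i)) \<Longrightarrow> polylt d (\<lambda>x y. \<Sum>i\<in>I. P i x y)"
  by (induction I rule: infinite_finite_induct) (auto intro: polylt.intros)

lemma polylt_mult_monom:
  "polylt d P \<Longrightarrow> i + j \<le> e \<Longrightarrow> polylt (d + e) (\<lambda>x y. P x y * (c * x ^ i * y ^ j))"
proof (induction rule: polylt.induct)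
  case (monom i' j' c')
  then show ?case using polylt.monom[of "i' + i" "j' + j" "d + e" "c' * c"]
    by (simp add: mult_ac power_add)
qed (auto simp: distrib_right intro: polylt.intros)

text \<open>The bounds are asymmetric: \<open>Suc e\<close> allows degree up to \<open>e\<close>,
  and this is multiplied with degree below \<open>d\<close>.\<close>

lemma polylt_mult: "polylt (Suc e) Q \<Longrightarrow> polylt d P \<Longrightarrow> polylt (d + e) (\<lambda>x y. P x y * Q x y)"
  by (induction rule: polylt.induct) (auto simp: distrib_left intro: polylt.intros polylt_mult_monom)

lemma polylt_1_const: "polylt 1 P \<Longrightarrow> \<exists>C. P = (\<lambda>x y. C)"
  by (induction rule: polylt.induct) (auto simp: fun_eq_iff)

lemma polylt_affine_x: "polylt 2 (\<lambda>x y. \<beta> * x + s)"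
  using polylt.add[OF polylt.monom[of 1 0 2 \<beta>] polylt.monom[of 0 0 2 s]] by simp

lemma polylt_affine_y: "polylt 2 (\<lambda>x y. y + s)"
  using polylt.add[OF polylt.monom[of 0 1 2 1] polylt.monom[of 0 0 2 s]] by simp

lemma polylt_affine_y_power: "polylt (Suc i) (\<lambda>x y. (y + s) ^ i)"
proof (induction i)
  case 0
  then show ?case using polylt.monom[of 0 0 1 1] by simp
next
  case (Suc i)
  from polylt_mult[OF _ this, of 1] polylt_affine_y[of s] show ?case
    by (simp add: numeral_2_eq_2 mult_ac)
qed

text \<open>Beyond first order, the remainder loses two degrees. In the induction, multiplying by
  \<open>\<beta> * x + s\<close> leaves one extra second-order term, the linear term times
  \<open>s\<close>.\<close>

lemma polylt_taylor_x:
  "polylt i (\<lambda>x y. (\<beta> * x + s) ^ Suc i - (\<beta> ^ Suc i * x ^ Suc i + real (Suc i) * \<beta> ^ i * s * x ^ i))"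
proof (induction i)
  case 0
  then show ?case using polylt.zero by simp
next
  case (Suc i)
  have "polylt (Suc i) (\<lambda>x y. ((\<beta> * x + s) ^ Suc i
      - (\<beta> ^ Suc i * x ^ Suc i + real (Suc i) * \<beta> ^ i * s * x ^ i)) * (\<beta> * x + s)
      + (real (Suc i) * \<beta> ^ i * s * s) * x ^ i * y ^ 0)"
    using polylt_mult[OF _ Suc, of 1] polylt_affine_x[of \<beta> s]
    by (intro polylt.add polylt.monom) (simp_all add: numeral_2_eq_2)
  then show ?case by (simp add: algebra_simps)
qed

lemma polylt_taylor_y:
  "polylt i (\<lambda>x y. (y + s) ^ Suc i - (y ^ Suc i + real (Suc i) * s * y ^ i))"
proof (induction i)
  case 0
  then show ?case using polylt.zero by simp
next
  case (Suc i)
  have "polylt (Suc i) (\<lambda>x y. ((y + s) ^ Suc i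
      - (y ^ Suc i + real (Suc i) * s * y ^ i)) * (y + s)
      + (real (Suc i) * s * s) * x ^ 0 * y ^ i)"
    using polylt_mult[OF _ Suc, of 1] polylt_affine_y[of s]
    by (intro polylt.add polylt.monom) (simp_all add: numeral_2_eq_2)
  then show ?case by (simp add: algebra_simps)
qed

text \<open>The product of the two one-variable expansions, cut off after first order. The truncated
  exponents \<open>i - 1\<close> and \<open>j - 1\<close> are harmless, since at 0 their terms carry
  the factor \<open>real i\<close> or \<open>real j\<close>.\<close>

lemma polylt_taylor:
  assumes "i + j = Suc d"
  shows "polylt d (\<lambda>x y. (\<beta> * x + s) ^ i * (y + t) ^ j - (\<beta> ^ i * x ^ i * y ^ j
      + (real i * \<beta> ^ (i - 1) * s * x ^ (i - 1) * y ^ j + real j * t * \<beta> ^ i * x ^ i * y ^ (j - 1))))"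
proof (cases i)
  case 0
  then show ?thesis using assms polylt_taylor_y[of d t] by simp
next
  case i: (Suc k)
  show ?thesis
  proof (cases j)
    case 0
    then show ?thesis using assms i polylt_taylor_x[of d \<beta> s] by simp
  next
    case j: (Suc l)
    \<comment> \<open>Write the two factors as \<open>a0 + a1 + X\<close> and
      \<open>b0 + b1 + Y\<close> by order in the translation. Removing
      \<open>a0 * b0 + a1 * b0 + a0 * b1\<close> from the product leaves \<open>X\<close> times the
      full second factor, \<open>Y * a0\<close>, \<open>Y * a1\<close> and \<open>a1 * b1\<close>,
      all of total degree below \<open>d\<close>.\<close>
    let ?X = "\<lambda>x y :: real. (\<beta> * x + s) ^ Suc k
        - (\<beta> ^ Suc k * x ^ Suc k + real (Suc k) * \<beta> ^ k * s * x ^ k)"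
    let ?Y = "\<lambda>x y :: real. (y + t) ^ Suc l - (y ^ Suc l + real (Suc l) * t * y ^ l)"
    have d: "d = Suc (k + l)" using assms i j by simp
    have "polylt (k + Suc l) (\<lambda>x y. ?X x y * (y + t) ^ Suc l)"
      by (intro polylt_mult polylt_taylor_x polylt_affine_y_power)
    moreover have "polylt (l + Suc k) (\<lambda>x y. ?Y x y * (\<beta> ^ Suc k * x ^ Suc k * y ^ 0))"
      by (intro polylt_mult_monom polylt_taylor_y) simp
    moreover have "polylt (l + k) (\<lambda>x y. ?Y x y * ((real (Suc k) * \<beta> ^ k * s) * x ^ k * y ^ 0))"
      by (intro polylt_mult_monom polylt_taylor_y) simp
    moreover have "polylt d (\<lambda>x y. (real (Suc k) * \<beta> ^ k * s * real (Suc l) * t) * x ^ k * y ^ l)"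
      by (intro polylt.monom) (simp add: d)
    ultimately have "polylt d (\<lambda>x y. ?X x y * (y + t) ^ Suc l
        + (?Y x y * (\<beta> ^ Suc k * x ^ Suc k * y ^ 0)
        + (?Y x y * ((real (Suc k) * \<beta> ^ k * s) * x ^ k * y ^ 0)
        + (real (Suc k) * \<beta> ^ k * s * real (Suc l) * t) * x ^ k * y ^ l)))"
      by (intro polylt.add) (auto elim!: polylt_mono simp: d)
    also have "(\<lambda>x y. ?X x y * (y + t) ^ Suc l
        + (?Y x y * (\<beta> ^ Suc k * x ^ Suc k * y ^ 0)
        + (?Y x y * ((real (Suc k) * \<beta> ^ k * s) * x ^ k * y ^ 0)
        + (real (Suc k) * \<beta> ^ k * s * real (Suc l) * t) * x ^ k * y ^ l)))
      = (\<lambda>x y. (\<beta> * x + s) ^ i * (y + t) ^ j - (\<beta> ^ i * x ^ i * y ^ j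
      + (real i * \<beta> ^ (i - 1) * s * x ^ (i - 1) * y ^ j + real j * t * \<beta> ^ i * x ^ i * y ^ (j - 1))))"
    proof (intro ext)
      fix x y
      define A B Yt where "A = (\<beta> * x + s) ^ Suc k" and "B = (y + t) ^ Suc l" and "Yt = y ^ Suc l"
      show "?X x y * (y + t) ^ Suc l
        + (?Y x y * (\<beta> ^ Suc k * x ^ Suc k * y ^ 0)
        + (?Y x y * ((real (Suc k) * \<beta> ^ k * s) * x ^ k * y ^ 0)
        + (real (Suc k) * \<beta> ^ k * s * real (Suc l) * t) * x ^ k * y ^ l))
      = (\<beta> * x + s) ^ i * (y + t) ^ j - (\<beta> ^ i * x ^ i * y ^ j
      + (real i * \<beta> ^ (i - 1) * s * x ^ (i - 1) * y ^ j + real j * t * \<beta> ^ i * x ^ i * y ^ (j - 1)))"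
        unfolding i j A_def[symmetric] B_def[symmetric] Yt_def[symmetric] diff_Suc_1
        by (simp only: power_0 mult_1_right) algebra
    qed
    finally show ?thesis .
  qed
qed

lemma polylt_monom_difference:
  assumes "i + j = Suc d"
  shows "polylt d (\<lambda>x y. ((\<beta> * x + s) ^ i * (y + t) ^ j - (\<beta> * x + s') ^ i * (y + t') ^ j)
      - (real i * \<beta> ^ (i - 1) * (s - s') * x ^ (i - 1) * y ^ j
         + real j * (t - t') * \<beta> ^ i * x ^ i * y ^ (j - 1)))"
  using polylt_diff[OF polylt_taylor[OF assms, of \<beta> s t] polylt_taylor[OF assms, of \<beta> s' t']]
  by (simp add: algebra_simps)

text \<open>In each monomial the leading term \<open>\<beta> ^ i * x ^ i * y ^ j\<close> is the same
  for both translations and cancels, so one degree is lost.\<close>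

lemma polylt_difference:
  "polylt (Suc d) L \<Longrightarrow> polylt d (\<lambda>x y. L (\<beta> * x + s) (y + t) - L (\<beta> * x + s') (y + t'))"
proof (induction rule: polylt.induct)
  case zero
  then show ?case using polylt.zero by simp
next
  case (monom i j c)
  show ?case
  proof (cases "i + j")
    case 0
    then show ?thesis using polylt.zero by simp
  next
    case (Suc e)
    let ?x = "\<lambda>x y. (real i * \<beta> ^ (i - 1) * (s - s')) * x ^ (i - 1) * y ^ j"
    let ?y = "\<lambda>x y. (real j * (t - t') * \<beta> ^ i) * x ^ i * y ^ (j - 1)"
    have le: "e < d" using monom Suc by simp
    have x: "polylt d ?x"
      using polylt.monom[of "i - 1" j d] polylt.zero[of d] le Suc by (cases i) auto
    have y: "polylt d ?y"
      using polylt.monom[of i "j - 1" d] polylt.zero[of d] le Suc by (cases j) auto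
    have "polylt d (\<lambda>x y. c * ((((\<beta> * x + s) ^ i * (y + t) ^ j - (\<beta> * x + s') ^ i * (y + t') ^ j)
      - (?x x y + ?y x y)) + (?x x y + ?y x y)))"
      by (intro polylt_cmult polylt.add x y polylt_mono[OF polylt_monom_difference[OF Suc]] less_imp_le le)
    then show ?thesis by (simp add: algebra_simps)
  qed
next
  case (add P Q)
  from polylt.add[OF add.IH] show ?case by (simp add: algebra_simps)
qed

definition hom :: "nat \<Rightarrow> (nat \<Rightarrow> real) \<Rightarrow> real \<Rightarrow> real \<Rightarrow> real" where
  "hom d a x y = (\<Sum>i\<le>d. a i * x ^ i * y ^ (d - i))"

text \<open>The coefficients of the directional derivative of \<open>hom (Suc d) a\<close> along
  \<open>(g, h)\<close>, evaluated at \<open>(\<beta> * x, y)\<close>.\<close>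

definition hom_difference :: "nat \<Rightarrow> real \<Rightarrow> real \<Rightarrow> real \<Rightarrow> (nat \<Rightarrow> real) \<Rightarrow> nat \<Rightarrow> real" where
  "hom_difference d \<beta> g h a i =
     \<beta> ^ i * (real (Suc i) * a (Suc i) * g + real (Suc d - i) * a i * h)"

lemma polylt_hom_difference:
  "polylt d (\<lambda>x y. (hom (Suc d) a (\<beta> * x + s) (y + t) - hom (Suc d) a (\<beta> * x + s') (y + t'))
     - hom d (hom_difference d \<beta> (s - s') (t - t') a) x y)"
proof -
  let ?x = "\<lambda>i x y. real i * \<beta> ^ (i - 1) * (s - s') * x ^ (i - 1) * y ^ (Suc d - i)"
  let ?y = "\<lambda>i x y. real (Suc d - i) * (t - t') * \<beta> ^ i * x ^ i * y ^ (Suc d - i - 1)"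
  have "hom d (hom_difference d \<beta> (s - s') (t - t') a) x y = (\<Sum>i\<le>Suc d. a i * (?x i x y + ?y i x y))" for x y
  proof -
    \<comment> \<open>The \<open>x\<close>-derivative lowers the index by one, and its term at
      \<open>i = 0\<close> vanishes; the \<open>y\<close>-derivative keeps the index, and its term
      at \<open>Suc d\<close> vanishes.\<close>
    have "(\<Sum>i\<le>Suc d. a i * ?x i x y) = (\<Sum>i\<le>d. a (Suc i) * ?x (Suc i) x y)"
      by (subst sum.atMost_Suc_shift) simp
    moreover have "(\<Sum>i\<le>Suc d. a i * ?y i x y) = (\<Sum>i\<le>d. a i * ?y i x y)"
      by simp
    ultimately have "(\<Sum>i\<le>Suc d. a i * (?x i x y + ?y i x y))
        = (\<Sum>i\<le>d. a (Suc i) * ?x (Suc i) x y + a i * ?y i x y)"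
      by (simp only: distrib_left sum.distrib)
    also have "\<dots> = hom d (hom_difference d \<beta> (s - s') (t - t') a) x y"
      unfolding hom_def hom_difference_def
      by (intro sum.cong refl) (simp add: Suc_diff_le algebra_simps)
    finally show ?thesis by simp
  qed
  moreover have "polylt d (\<lambda>x y. \<Sum>i\<le>Suc d. a i * (((\<beta> * x + s) ^ i * (y + t) ^ (Suc d - i)
      - (\<beta> * x + s') ^ i * (y + t') ^ (Suc d - i)) - (?x i x y + ?y i x y)))"
    by (intro polylt_sum polylt_cmult polylt_monom_difference) simp
  ultimately show ?thesis
    unfolding hom_def[of "Suc d"] by (simp only: right_diff_distrib sum_subtractf mult.assoc)
qed

section \<open>Decay for an irrational form of top degree\<close>

lemma rational_of_nat_mult:
  fixes x :: real
  assumes "k > 0" "real k * x \<in> \<rat>"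
  shows "x \<in> \<rat>"
  using Rats_divide[OF assms(2) Rats_of_nat[of k]] assms(1) by simp

text \<open>Two linearly independent integer vectors with rational values would make
  \<open>\<alpha>\<close> and \<open>\<beta>\<close> rational by Cramer's rule. So these vectors lie
  on one line, and \<open>a\<close>, \<open>c\<close> are the coefficients of an integral equation
  of such a line.\<close>

lemma rational_vectors_collinear:
  fixes \<alpha> \<beta> :: real
  assumes "\<alpha> \<notin> \<rat> \<or> \<beta> \<notin> \<rat>"
  shows "\<exists>a c :: int. (a, c) \<noteq> (0, 0) \<and>
    (\<forall>g h :: int. \<alpha> * of_int g + \<beta> * of_int h \<in> \<rat> \<longrightarrow> a * g + c * h = 0)"
proof (cases "\<exists>g h :: int. (g, h) \<noteq> (0, 0) \<and> \<alpha> * of_int g + \<beta> * of_int h \<in> \<rat>")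
  case True
  then obtain p r :: int where pr: "(p, r) \<noteq> (0, 0)" "\<alpha> * of_int p + \<beta> * of_int r \<in> \<rat>" by blast
  have "r * g + (- p) * h = 0" if gh: "\<alpha> * of_int g + \<beta> * of_int h \<in> \<rat>" for g h
  proof (rule ccontr)
    \<comment> \<open>The determinant of the two vectors \<open>(g, h)\<close> and
      \<open>(p, r)\<close>, up to sign.\<close>
    define \<Delta> :: real where "\<Delta> = of_int (r * g + (- p) * h)"
    assume "r * g + (- p) * h \<noteq> 0"
    then have \<Delta>: "\<Delta> \<noteq> 0" by (simp only: \<Delta>_def of_int_eq_0_iff not_False_eq_True)
    have "((\<alpha> * of_int g + \<beta> * of_int h) * of_int r - (\<alpha> * of_int p + \<beta> * of_int r) * of_int h) / \<Delta> \<in> \<rat>"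
      "((\<alpha> * of_int p + \<beta> * of_int r) * of_int g - (\<alpha> * of_int g + \<beta> * of_int h) * of_int p) / \<Delta> \<in> \<rat>"
      by (intro Rats_divide Rats_diff Rats_mult gh pr Rats_of_int; simp add: \<Delta>_def)+
    moreover have "(\<alpha> * of_int g + \<beta> * of_int h) * of_int r - (\<alpha> * of_int p + \<beta> * of_int r) * of_int h = \<alpha> * \<Delta>"
      "(\<alpha> * of_int p + \<beta> * of_int r) * of_int g - (\<alpha> * of_int g + \<beta> * of_int h) * of_int p = \<beta> * \<Delta>"
      by (simp_all add: \<Delta>_def algebra_simps)
    ultimately show False using assms \<Delta> by simp
  qed
  then show ?thesis using pr by (intro exI[of _ r] exI[of _ "- p"]) auto
next
  case False
  then show ?thesis by (intro exI[of _ 0] exI[of _ 1]) auto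
qed

context digit_system
begin

text \<open>Induction on the degree by differencing. A chosen coefficient of the differenced form is
  a power of \<open>\<beta>\<close> times a linear expression in the differences of
  \<open>\<kappa>\<close> and \<open>\<sigma>\<close>. It can be rational only on one line, and
  pairs on that line are exactly the collisions permitted in
  \<open>decays_of_differences\<close>.\<close>

lemma decays_hom_plus_lower:
  assumes "i \<le> Suc d" "a i \<notin> \<rat>" "polylt (Suc d) L"
  shows "decays (\<lambda>x y. hom (Suc d) a x y + L x y)"
  using assms
proof (induction d arbitrary: a i L)
  case 0
  then obtain C where "L = (\<lambda>x y. C)" using polylt_1_const by auto
  moreover have "a 1 \<notin> \<rat> \<or> a 0 \<notin> \<rat>" using 0 by (cases i) auto
  ultimately show ?case using decays_linear[of "a 1" "a 0" C]
    by (simp add: hom_def add_ac)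
next
  case (Suc d)
  \<comment> \<open>The coefficient at \<open>j\<close> involves \<open>a j\<close> and
    \<open>a (Suc j)\<close>, so \<open>j\<close> is chosen with \<open>i\<close> among these two
    indices and within the range of the form of lower degree.\<close>
  define j where "j = (if i \<le> Suc d then i else i - 1)"
  have j: "j \<le> Suc d" using Suc.prems by (auto simp: j_def)
  have "real (Suc j) * a (Suc j) \<notin> \<rat> \<or> real (Suc (Suc d) - j) * a j \<notin> \<rat>"
  proof (rule ccontr)
    assume "\<not> ?thesis"
    moreover have "Suc (Suc d) - j > 0" using j by simp
    ultimately have "a (Suc j) \<in> \<rat>" "a j \<in> \<rat>"
      using rational_of_nat_mult zero_less_Suc by blast+
    moreover have "i = j \<or> i = Suc j" using Suc.prems by (auto simp: j_def)
    ultimately show False using Suc.prems by auto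
  qed
  then obtain p r :: int where pr: "(p, r) \<noteq> (0, 0)" and line:
    "\<And>g h :: int. real (Suc j) * a (Suc j) * of_int g + real (Suc (Suc d) - j) * a j * of_int h \<in> \<rat>
       \<Longrightarrow> p * g + r * h = 0"
    using rational_vectors_collinear by metis
  show ?case
  proof (rule decays_of_differences[OF pr])
    fix m n k
    assume ne: "p * int (\<kappa> n) + r * int (\<sigma> n) \<noteq> p * int (\<kappa> k) + r * int (\<sigma> k)"
    define \<beta> where "\<beta> = real b ^ m"
    define a' where "a' = hom_difference (Suc d) \<beta> (real (\<kappa> n) - real (\<kappa> k)) (real (\<sigma> n) - real (\<sigma> k)) a"
    let ?P = "\<lambda>x y. hom (Suc (Suc d)) a x y + L x y"
    let ?Q = "\<lambda>x y. ?P (\<beta> * x + real (\<kappa> n)) (y + real (\<sigma> n)) - ?P (\<beta> * x + real (\<kappa> k)) (y + real (\<sigma> k))"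
    have low: "polylt (Suc d) (\<lambda>x y. ?Q x y - hom (Suc d) a' x y)"
      using polylt.add[OF polylt_hom_difference[of "Suc d" a \<beta> "real (\<kappa> n)" "real (\<sigma> n)" "real (\<kappa> k)" "real (\<sigma> k)"]
          polylt_difference[OF Suc.prems(3), of \<beta> "real (\<kappa> n)" "real (\<sigma> n)" "real (\<kappa> k)" "real (\<sigma> k)"]]
      by (simp add: a'_def algebra_simps)
    have irr: "a' j \<notin> \<rat>"
    proof
      assume "a' j \<in> \<rat>"
      then have "a' j / \<beta> ^ j \<in> \<rat>" by (intro Rats_divide) (auto simp: \<beta>_def)
      then have "real (Suc j) * a (Suc j) * of_int (int (\<kappa> n) - int (\<kappa> k))
          + real (Suc (Suc d) - j) * a j * of_int (int (\<sigma> n) - int (\<sigma> k)) \<in> \<rat>"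
        using b_ge_2 by (simp add: a'_def hom_difference_def \<beta>_def)
      from line[OF this] ne show False by (simp add: algebra_simps)
    qed
    have "(\<lambda>x y. hom (Suc d) a' x y + (?Q x y - hom (Suc d) a' x y)) = ?Q"
      by (intro ext) linarith
    with Suc.IH[of j a', OF j irr low] have "decays ?Q" by (simp only:)
    show "decays (\<lambda>x y. ?P (real b ^ m * x + real (\<kappa> n)) (y + real (\<sigma> n))
                       - ?P (real b ^ m * x + real (\<kappa> k)) (y + real (\<sigma> k)))"
      using \<open>decays ?Q\<close> by (simp only: \<beta>_def)
  qed
qed

end

section \<open>Polynomials with some irrational coefficient\<close>

lemma rational_common_denominator:
  fixes S :: "real set"
  assumes "finite S" "S \<subseteq> \<rat>"
  shows "\<exists>Q :: nat. Q > 0 \<and> (\<forall>x\<in>S. real Q * x \<in> \<int>)"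
  using assms
proof (induction S)
  case empty
  then show ?case by (intro exI[of _ 1]) simp
next
  case (insert x S)
  then obtain Q :: nat where Q: "Q > 0" "\<forall>x\<in>S. real Q * x \<in> \<int>" by auto
  from insert.prems obtain a b :: int where ab: "b > 0" "x = of_int a / of_int b"
    by (auto elim: Rats_cases')
  have "real (Q * nat b) * x = of_int (int Q * a)"
    using ab by simp
  then have 1: "real (Q * nat b) * x \<in> \<int>" by (metis Ints_of_int)
  have 2: "real (Q * nat b) * y \<in> \<int>" if "y \<in> S" for y
  proof -
    have "real (Q * nat b) * y = of_nat (nat b) * (real Q * y)" by (simp add: mult_ac)
    then show ?thesis using Q(2) that by (metis Ints_mult Ints_of_nat)
  qed
  from 1 2 show ?case using Q(1) ab(1) by (intro exI[of _ "Q * nat b"]) auto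
qed

lemma poly2_add: "poly2 d (\<lambda>i j. c i j + c' i j) x y = poly2 d c x y + poly2 d c' x y"
  by (simp add: poly2_def algebra_simps sum.distrib)

lemma poly2_cmult: "poly2 d (\<lambda>i j. k * c i j) x y = k * poly2 d c x y"
  by (simp add: poly2_def sum_distrib_left mult_ac)

lemma poly2_monom:
  assumes "i0 \<le> d" "j0 \<le> d"
  shows "poly2 d (\<lambda>i j. if i = i0 \<and> j = j0 then k else 0) x y = k * x ^ i0 * y ^ j0"
proof -
  have "poly2 d (\<lambda>i j. if i = i0 \<and> j = j0 then k else 0) x y
      = (\<Sum>i\<le>d. \<Sum>j\<le>d. if i = i0 then (if j = j0 then k * x ^ i0 * y ^ j0 else 0) else 0)"
    unfolding poly2_def by (intro sum.cong refl) auto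
  also have "\<dots> = (\<Sum>i\<le>d. if i = i0 then (\<Sum>j\<le>d. if j = j0 then k * x ^ i0 * y ^ j0 else 0) else 0)"
    by (intro sum.cong refl) auto
  finally show ?thesis using assms by simp
qed

lemma ee_poly2_periodic:
  assumes "Q > 0" and c: "\<And>i j. i \<le> d \<Longrightarrow> j \<le> d \<Longrightarrow> real Q * c i j \<in> \<int>"
  shows "ee (poly2 d c (real x) (real y)) = ee (poly2 d c (real (x mod Q)) (real (y mod Q)))"
proof -
  have "c i j * real x ^ i * real y ^ j - c i j * real (x mod Q) ^ i * real (y mod Q) ^ j \<in> \<int>"
    if "i \<le> d" "j \<le> d" for i j
  proof -
    have "(int x ^ i * int y ^ j) mod int Q = (int (x mod Q) ^ i * int (y mod Q) ^ j) mod int Q"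
      by (intro mod_mult_cong) (simp_all add: of_nat_mod power_mod)
    then have "int Q dvd int x ^ i * int y ^ j - int (x mod Q) ^ i * int (y mod Q) ^ j"
      by (simp only: mod_eq_dvd_iff)
    then obtain k where "int x ^ i * int y ^ j - int (x mod Q) ^ i * int (y mod Q) ^ j = int Q * k" ..
    then have "real_of_int (int x ^ i * int y ^ j - int (x mod Q) ^ i * int (y mod Q) ^ j) = of_int (int Q * k)"
      by (simp only:)
    then have k: "real x ^ i * real y ^ j - real (x mod Q) ^ i * real (y mod Q) ^ j = real Q * of_int k"
      by simp
    have "c i j * real x ^ i * real y ^ j - c i j * real (x mod Q) ^ i * real (y mod Q) ^ j
        = c i j * (real x ^ i * real y ^ j - real (x mod Q) ^ i * real (y mod Q) ^ j)"
      by (simp add: algebra_simps)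
    also have "\<dots> = (real Q * c i j) * of_int k" unfolding k by simp
    finally show ?thesis using Ints_mult[OF c[OF that] Ints_of_int[of k]] by simp
  qed
  then have "poly2 d c (real x) (real y) - poly2 d c (real (x mod Q)) (real (y mod Q)) \<in> \<int>"
    unfolding poly2_def sum_subtractf[symmetric] by (intro Ints_sum) auto
  then have "ee (poly2 d c (real (x mod Q)) (real (y mod Q))
      + (poly2 d c (real x) (real y) - poly2 d c (real (x mod Q)) (real (y mod Q))))
      = ee (poly2 d c (real (x mod Q)) (real (y mod Q))) * 1"
    unfolding ee_add by (simp only: flip: ee_eq_1_iff)
  then show ?thesis by simp
qed

text \<open>Orthogonality of the characters of the integers modulo \<open>Q\<close>: a geometric sum
  whose ratio \<open>\<omega>\<close> is a \<open>Q\<close>-th root of unity.\<close>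

lemma sum_characters_mod:
  assumes "Q > 0" "r < Q"
  shows "(\<Sum>a<Q. ee (real a * (real x - real r) / real Q)) = (if r = x mod Q then of_nat Q else 0)"
proof -
  define \<omega> where "\<omega> = ee ((real x - real r) / real Q)"
  have pow: "ee (real a * (real x - real r) / real Q) = \<omega> ^ a" for a
    unfolding \<omega>_def ee_mult_nat[symmetric] by simp
  have one: "\<omega> = 1 \<longleftrightarrow> r = x mod Q"
  proof
    assume "\<omega> = 1"
    then obtain k :: int where "(real x - real r) / real Q = of_int k"
      unfolding \<omega>_def ee_eq_1_iff by (auto elim: Ints_cases)
    then have "real_of_int (int x - int r) = of_int (k * int Q)"
      using assms by (simp add: field_simps)
    then have "int x - int r = k * int Q" by (simp only: of_int_eq_iff)
    then have "int x mod int Q = int r mod int Q"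
      by (simp add: mod_eq_dvd_iff)
    then show "r = x mod Q" using assms by (simp flip: of_nat_mod)
  next
    assume "r = x mod Q"
    then have "real x = real (x div Q) * real Q + real r"
      by (metis div_mult_mod_eq of_nat_add of_nat_mult)
    then have "(real x - real r) / real Q = of_int (int (x div Q))" using assms by simp
    then show "\<omega> = 1" unfolding \<omega>_def by (simp only: ee_of_int)
  qed
  show ?thesis
  proof (cases "\<omega> = 1")
    case True
    then have "r = x mod Q" using one by blast
    then show ?thesis unfolding pow using True by simp
  next
    case False
    have "\<omega> ^ Q = ee (of_int (int x - int r))"
      unfolding \<omega>_def ee_mult_nat[symmetric] using assms by simp
    then have "\<omega> ^ Q = 1" by (simp only: ee_of_int)
    then show ?thesis using False one by (simp add: pow geometric_sum)
  qed
qed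

text \<open>The two end corrections cost at most \<open>H\<close> each. The run of complete blocks
  begins with the block containing \<open>M\<close>, so it may be longer than \<open>N - M\<close>,
  but by at most \<open>H\<close>; this gives the extra \<open>\<epsilon> * H\<close>.\<close>

lemma norm_sum_of_block_bound:
  fixes f :: "nat \<Rightarrow> complex"
  assumes H: "H > 0" and f1: "\<And>n. norm (f n) \<le> 1" and eps: "\<epsilon> \<ge> 0"
    and block: "\<And>k. norm (\<Sum>r<H. f (H * k + r)) \<le> \<epsilon> * real H"
    and MN: "M \<le> N"
  shows "norm (\<Sum>n\<in>{M..<N}. f n) \<le> \<epsilon> * real (N - M) + (2 + \<epsilon>) * real H"
proof -
  define A B where "A = M div H" and "B = N div H"
  define S where "S n = (\<Sum>i<n. f i)" for n
  have AB: "A \<le> B" using MN by (simp add: A_def B_def div_le_mono)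
  have S_diff: "S n - S m = (\<Sum>i\<in>{m..<n}. f i)" if "m \<le> n" for m n
    using sum_diff_nat_ivl[of 0 m n f] that by (simp add: S_def atLeast0LessThan)
  have round: "norm (S n - S (H * (n div H))) \<le> real H" for n
  proof -
    have "norm (S n - S (H * (n div H))) \<le> (\<Sum>i\<in>{H * (n div H)..<n}. 1)"
      unfolding S_diff[OF times_div_less_eq_dividend] by (rule sum_norm_le) (rule f1)
    moreover have "card {H * (n div H)..<n} = n mod H" by (simp add: minus_mult_div_eq_mod)
    ultimately have "norm (S n - S (H * (n div H))) \<le> real (n mod H)"
      by (simp only: sum_constant mult_1_right)
    also have "\<dots> \<le> real H" using H by (simp add: less_imp_le)
    finally show ?thesis .
  qed
  have blocks: "S (H * k) = (\<Sum>j<k. \<Sum>r<H. f (H * j + r))" for k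
    unfolding S_def by (rule sum_blocks)
  have "S (H * B) - S (H * A) = (\<Sum>j\<in>{A..<B}. \<Sum>r<H. f (H * j + r))"
    unfolding blocks using sum_diff_nat_ivl[of 0 A B "\<lambda>j. \<Sum>r<H. f (H * j + r)"] AB
    by (simp add: atLeast0LessThan)
  then have "norm (S (H * B) - S (H * A)) \<le> (\<Sum>j\<in>{A..<B}. \<epsilon> * real H)"
    by (simp only:) (intro sum_norm_le block)
  also have "\<dots> = \<epsilon> * real (H * B - H * A)" 
    by (simp add: diff_mult_distrib2[symmetric] del: of_nat_diff)
  also have "\<dots> \<le> \<epsilon> * real (N - M + H)"
  proof (intro mult_left_mono eps)
    have "H * B \<le> N" by (simp add: B_def)
    moreover have "M \<le> H * A + H"
      using H mod_less_divisor[OF H, of M] mult_div_mod_eq[of H M] unfolding A_def by linarith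
    ultimately show "real (H * B - H * A) \<le> real (N - M + H)" by simp
  qed
  finally have mid: "norm (S (H * B) - S (H * A)) \<le> \<epsilon> * real (N - M) + \<epsilon> * real H"
    by (simp add: algebra_simps)
  have "(\<Sum>n\<in>{M..<N}. f n) = (S N - S (H * B)) + (S (H * B) - S (H * A)) + (S (H * A) - S M)"
    using S_diff[OF MN] by simp
  then have "norm (\<Sum>n\<in>{M..<N}. f n) \<le> norm (S N - S (H * B)) + norm (S (H * B) - S (H * A)) + norm (S (H * A) - S M)"
    by (metis norm_triangle_ineq norm_triangle_le add_right_mono)
  also have "\<dots> \<le> real H + (\<epsilon> * real (N - M) + \<epsilon> * real H) + real H"
    using round[of N] round[of M] mid by (intro add_mono) (simp_all add: A_def B_def norm_minus_commute)
  finally show ?thesis by (simp add: algebra_simps)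
qed

lemma avg_tends_zero_of_blocks:
  assumes f1: "\<And>n. norm (f n) \<le> 1"
    and block: "\<And>\<epsilon>. \<epsilon> > 0 \<Longrightarrow> \<exists>H>0. \<forall>k. norm (\<Sum>r<H. f (H * k + r)) \<le> \<epsilon> * real H"
  shows "avg_tends_zero (\<lambda>n. f (n - 1))"
  unfolding avg_tends_zero_def
proof (intro allI impI)
  fix \<eta> :: real assume eta: "\<eta> > 0"
  obtain H where H: "H > 0" and Hb: "\<And>k. norm (\<Sum>r<H. f (H * k + r)) \<le> \<eta> / 2 * real H"
    using block[of "\<eta> / 2"] eta by auto
  \<comment> \<open>For this \<open>L\<close> the boundary term stays below half of
    \<open>\<eta> * (N - M)\<close>.\<close>
  obtain L :: nat where L: "real L > (2 + \<eta> / 2) * real H / (\<eta> / 2)" using reals_Archimedean2 by blast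
  have "norm ((\<Sum>n\<in>{M<..N}. f (n - 1)) / of_nat (N - M)) < \<eta>" if MN: "M < N" "N - M \<ge> L" for M N
  proof -
    have "(\<Sum>n\<in>{M<..N}. f (n - 1)) = (\<Sum>n\<in>{M..<N}. f n)"
      by (rule sum.reindex_bij_witness[of _ Suc "\<lambda>n. n - 1"]) auto
    then have "norm (\<Sum>n\<in>{M<..N}. f (n - 1)) \<le> \<eta> / 2 * real (N - M) + (2 + \<eta> / 2) * real H"
      using norm_sum_of_block_bound[OF H f1 _ Hb, of M N] eta MN by simp
    moreover have "(2 + \<eta> / 2) * real H < \<eta> / 2 * real L" using L eta by (simp add: field_simps)
    moreover have "\<eta> / 2 * real L \<le> \<eta> / 2 * real (N - M)" using MN eta by (intro mult_left_mono) auto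
    ultimately have "norm (\<Sum>n\<in>{M<..N}. f (n - 1)) < \<eta> * real (N - M)" by simp
    then show ?thesis using MN by (simp add: norm_divide divide_less_eq del: of_nat_diff)
  qed
  then show "\<exists>L. \<forall>M N. M < N \<and> N - M \<ge> L \<longrightarrow> norm ((\<Sum>n\<in>{M<..N}. f (n - 1)) / of_nat (N - M)) < \<eta>"
    by blast
qed

section \<open>Arbitrary polynomials along digit strings\<close>

context digit_system
begin

lemma decays_poly2:
  assumes top: "i0 \<le> d" "j0 \<le> d" "i0 + j0 > 0" "c i0 j0 \<notin> \<rat>"
    and zero: "\<And>i j. i \<le> d \<Longrightarrow> j \<le> d \<Longrightarrow> i + j > i0 + j0 \<Longrightarrow> c i j = 0"
  shows "decays (poly2 d c)"
proof -
  obtain e where e: "i0 + j0 = Suc e" using top(3) by (cases "i0 + j0") auto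
  \<comment> \<open>The form of degree \<open>Suc e\<close> runs over all indices up to
    \<open>Suc e\<close>, so its coefficients outside the square of exponents up to \<open>d\<close>
    are set to 0.\<close>
  define a where "a i = (if i \<le> d \<and> Suc e - i \<le> d then c i (Suc e - i) else 0)" for i
  define L where "L x y = (\<Sum>i\<le>d. \<Sum>j\<le>d. (if i + j < Suc e then c i j else 0) * x ^ i * y ^ j)" for x y
  have "poly2 d c x y = hom (Suc e) a x y + L x y" for x y
  proof -
    have "poly2 d c x y = (\<Sum>i\<le>d. \<Sum>j\<le>d. (if i + j = Suc e then c i j * x ^ i * y ^ j else 0)) + L x y"
      unfolding poly2_def L_def sum.distrib[symmetric]
      by (intro sum.cong refl) (use zero e in \<open>auto simp: not_less\<close>)
    also have "(\<Sum>i\<le>d. \<Sum>j\<le>d. (if i + j = Suc e then c i j * x ^ i * y ^ j else 0))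
        = (\<Sum>i\<le>d. if i \<le> Suc e then a i * x ^ i * y ^ (Suc e - i) else 0)"
    proof (intro sum.cong refl)
      fix i assume i: "i \<in> {..d}"
      show "(\<Sum>j\<le>d. (if i + j = Suc e then c i j * x ^ i * y ^ j else 0))
        = (if i \<le> Suc e then a i * x ^ i * y ^ (Suc e - i) else 0)"
      proof (cases "i \<le> Suc e")
        case True
        then have "i + j = Suc e \<longleftrightarrow> j = Suc e - i" for j by auto
        then show ?thesis using True i by (simp add: a_def)
      qed auto
    qed
    also have "\<dots> = hom (Suc e) a x y"
      unfolding hom_def
      by (rule sum.mono_neutral_cong) (auto simp: a_def)
    finally show ?thesis .
  qed
  then have "poly2 d c = (\<lambda>x y. hom (Suc e) a x y + L x y)" by blast
  moreover have "polylt (Suc e) L"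
    unfolding L_def
  proof (intro polylt_sum)
    fix i j
    show "polylt (Suc e) (\<lambda>x y. (if i + j < Suc e then c i j else 0) * x ^ i * y ^ j)"
      using polylt.monom[of i j "Suc e"] polylt.zero by (cases "i + j < Suc e") auto
  qed
  moreover have "Suc e - i0 = j0" using e by simp
  then have "i0 \<le> Suc e" "a i0 \<notin> \<rat>" using e top by (simp_all add: a_def)
  ultimately show ?thesis using decays_hom_plus_lower by simp
qed

text \<open>Split the coefficients into irrational ones \<open>ci\<close> and rational ones
  \<open>cr\<close>. With \<open>Q\<close> a common denominator, e of the rational part depends only
  on residues modulo \<open>Q\<close>, and its character expansion adds to \<open>ci\<close> only
  linear terms with coefficients in multiples of \<open>1 / Q\<close>.\<close>

lemma block_sums_poly2:
  assumes irr: "has_irr_nonconst_coeff d c" and eps: "\<epsilon> > 0"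
  shows "\<exists>m. \<forall>n. norm (\<Sum>r<q ^ m. ee (poly2 d c (real (\<kappa> (q ^ m * n + r))) (real (\<sigma> (q ^ m * n + r)))))
            \<le> \<epsilon> * real (q ^ m)"
proof -
  let ?S = "{p \<in> {..d} \<times> {..d}. p \<noteq> (0, 0) \<and> c (fst p) (snd p) \<notin> \<rat>}"
  obtain p0 where "p0 \<in> ?S" using irr unfolding has_irr_nonconst_coeff_def by fastforce
  moreover have "\<forall>p. p \<in> ?S \<longrightarrow> fst p + snd p < Suc (d + d)" by auto
  \<comment> \<open>Choose an irrational non-constant coefficient of greatest total degree. Above
    that degree \<open>ci\<close> vanishes, as \<open>decays_poly2\<close> demands.\<close>
  ultimately have "\<exists>p. p \<in> ?S \<and> (\<forall>p'. p' \<in> ?S \<longrightarrow> fst p' + snd p' \<le> fst p + snd p)"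
    by (rule ex_has_greatest_nat)
  then obtain p where p: "p \<in> ?S" "\<forall>p'. p' \<in> ?S \<longrightarrow> fst p' + snd p' \<le> fst p + snd p"
    by (elim exE conjE) (rule that)
  define ci where "ci i j = (if c i j \<in> \<rat> then 0 else c i j)" for i j
  define cr where "cr i j = (if c i j \<in> \<rat> then c i j else 0)" for i j
  have c_split: "c = (\<lambda>i j. ci i j + cr i j)" by (auto simp: ci_def cr_def fun_eq_iff)
  have "\<exists>Q :: nat. Q > 0 \<and> (\<forall>x\<in>(\<lambda>(i, j). cr i j) ` ({..d} \<times> {..d}). real Q * x \<in> \<int>)"
    by (rule rational_common_denominator) (auto simp: cr_def)
  then obtain Q :: nat where Q0: "Q > 0"
    and Q: "\<And>i j. i \<le> d \<Longrightarrow> j \<le> d \<Longrightarrow> real Q * cr i j \<in> \<int>" by fastforce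
  define ca where "ca = (\<lambda>(a :: nat, e :: nat) i j. ci i j + (if i = 1 \<and> j = 0 then real a / real Q else 0)
      + (if i = 0 \<and> j = 1 then real e / real Q else 0))"
  have d1: "d \<ge> 1" using p(1) by (cases p) auto
  have ca: "poly2 d (ca (a, e)) x y = poly2 d ci x y + real a * x / real Q + real e * y / real Q" for a e x y
    using d1 by (simp add: ca_def poly2_add poly2_monom)
  have "decays (poly2 d (ca ae))" for ae
  proof (rule decays_poly2[of "fst p" d "snd p"])
    show "fst p \<le> d" "snd p \<le> d" "fst p + snd p > 0" using p(1) by (cases p; force)+
    \<comment> \<open>The rational amount added to the coefficient at \<open>p\<close>, nonzero only
      if \<open>p\<close> has degree 1; irrationality of the coefficient survives it.\<close>
    define R where "R = (if fst p = 1 \<and> snd p = 0 then real (fst ae) / real Q else 0)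
      + (if fst p = 0 \<and> snd p = 1 then real (snd ae) / real Q else 0)"
    have ca_p: "ca ae (fst p) (snd p) - R = c (fst p) (snd p)"
      using p(1) by (simp add: R_def ca_def ci_def case_prod_unfold)
    have "R \<in> \<rat>" unfolding R_def by (intro Rats_add) auto
    then have "c (fst p) (snd p) \<in> \<rat>" if "ca ae (fst p) (snd p) \<in> \<rat>"
      using Rats_diff[OF that, of R] ca_p by simp
    then show "ca ae (fst p) (snd p) \<notin> \<rat>" using p(1) by auto
    fix i j assume ij: "i \<le> d" "j \<le> d" "fst p + snd p < i + j"
    have "(i, j) \<notin> ?S"
    proof
      assume "(i, j) \<in> ?S"
      from p(2)[rule_format, OF this] ij show False by simp
    qed
    then have "ci i j = 0" using ij by (auto simp: ci_def)
    moreover have "i + j > 1" using ij \<open>fst p + snd p > 0\<close> by linarith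
    ultimately show "ca ae i j = 0" by (auto simp: ca_def case_prod_unfold)
  qed
  \<comment> \<open>The expansion has \<open>Q ^ 4\<close> terms and represents \<open>Q ^ 2\<close>
    times the sum, hence the tolerance \<open>\<epsilon>\<close> divided by the square of
    \<open>Q\<close>.\<close>
  then have "\<exists>m0. \<forall>m\<ge>m0. \<forall>i\<in>{..<Q} \<times> {..<Q}. \<forall>u v.
      norm (esum (poly2 d (ca i)) m u v) \<le> \<epsilon> / (real Q)\<^sup>2 * real q ^ m"
    using eps Q0 by (intro decays_uniform) auto
  then obtain m where m: "\<And>i u v. i \<in> {..<Q} \<times> {..<Q} \<Longrightarrow>
      norm (esum (poly2 d (ca i)) m u v) \<le> \<epsilon> / (real Q)\<^sup>2 * real q ^ m" by blast
  define w where "w r s a e = ee (poly2 d cr (real r) (real s) - real a * real r / real Q - real e * real s / real Q)"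
    for r s a e :: nat
  have expand: "(of_nat Q)\<^sup>2 * ee (poly2 d c (real x) (real y))
      = (\<Sum>r<Q. \<Sum>s<Q. \<Sum>a<Q. \<Sum>e<Q. w r s a e * ee (poly2 d (ca (a, e)) (real x) (real y)))" for x y :: nat
  proof -
    have expand_term: "w r s a e * ee (poly2 d (ca (a, e)) (real x) (real y))
        = ee (poly2 d ci (real x) (real y)) * ee (poly2 d cr (real r) (real s))
          * (ee (real a * (real x - real r) / real Q) * ee (real e * (real y - real s) / real Q))" for r s a e
      unfolding w_def ca ee_add[symmetric] using Q0
      by (intro arg_cong[of _ _ ee]) (simp add: field_simps)
    have inner: "(\<Sum>a<Q. \<Sum>e<Q. w r s a e * ee (poly2 d (ca (a, e)) (real x) (real y)))
        = (if s = y mod Q then (if r = x mod Q then (of_nat Q)\<^sup>2 * (ee (poly2 d ci (real x) (real y))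
            * ee (poly2 d cr (real r) (real s))) else 0) else 0)" if "r < Q" "s < Q" for r s
      unfolding expand_term sum_distrib_left[symmetric] sum_distrib_right[symmetric]
        sum_characters_mod[OF Q0 that(1)] sum_characters_mod[OF Q0 that(2)]
      by (simp add: power2_eq_square)
    have "(\<Sum>r<Q. \<Sum>s<Q. \<Sum>a<Q. \<Sum>e<Q. w r s a e * ee (poly2 d (ca (a, e)) (real x) (real y)))
        = (\<Sum>r<Q. \<Sum>s<Q. if s = y mod Q then (if r = x mod Q then (of_nat Q)\<^sup>2 * (ee (poly2 d ci (real x) (real y))
            * ee (poly2 d cr (real r) (real s))) else 0) else 0)"
      by (intro sum.cong refl inner) auto
    also have "\<dots> = (of_nat Q)\<^sup>2 * (ee (poly2 d ci (real x) (real y))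
            * ee (poly2 d cr (real (x mod Q)) (real (y mod Q))))"
      using Q0 by simp
    also have "ee (poly2 d cr (real (x mod Q)) (real (y mod Q))) = ee (poly2 d cr (real x) (real y))"
      using ee_poly2_periodic[of Q d cr x y, OF Q0 Q] by simp
    also have "ee (poly2 d ci (real x) (real y)) * ee (poly2 d cr (real x) (real y)) = ee (poly2 d c (real x) (real y))"
      unfolding ee_add[symmetric] poly2_add[symmetric] c_split ..
    finally show ?thesis by simp
  qed
  have "norm (\<Sum>r<q ^ m. ee (poly2 d c (real (\<kappa> (q ^ m * n + r))) (real (\<sigma> (q ^ m * n + r)))))
            \<le> \<epsilon> * real (q ^ m)" for n
  proof -
    let ?u = "real (b ^ m * \<kappa> n)" and ?v = "real (\<sigma> n)"
    let ?X = "\<lambda>k. \<kappa> (q ^ m * n + k)" and ?Y = "\<lambda>k. \<sigma> (q ^ m * n + k)"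
    have es: "(\<Sum>k<q ^ m. ee (P (real (?X k)) (real (?Y k)))) = esum P m ?u ?v" for P
      unfolding esum_def by (intro sum.cong refl) (simp add: \<kappa>_concat \<sigma>_concat)
    have "(of_nat Q)\<^sup>2 * (\<Sum>k<q ^ m. ee (poly2 d c (real (?X k)) (real (?Y k))))
        = (\<Sum>k<q ^ m. \<Sum>r<Q. \<Sum>s<Q. \<Sum>a<Q. \<Sum>e<Q. w r s a e * ee (poly2 d (ca (a, e)) (real (?X k)) (real (?Y k))))"
      by (simp add: sum_distrib_left expand)
    also have "\<dots> = (\<Sum>r<Q. \<Sum>s<Q. \<Sum>a<Q. \<Sum>e<Q. \<Sum>k<q ^ m. w r s a e * ee (poly2 d (ca (a, e)) (real (?X k)) (real (?Y k))))"
      by ((subst sum.swap, rule sum.cong[OF refl])+) (rule refl)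
    also have "\<dots> = (\<Sum>r<Q. \<Sum>s<Q. \<Sum>a<Q. \<Sum>e<Q. w r s a e * esum (poly2 d (ca (a, e))) m ?u ?v)"
      by (simp only: sum_distrib_left[symmetric] es)
    finally have eq: "(of_nat Q)\<^sup>2 * (\<Sum>k<q ^ m. ee (poly2 d c (real (?X k)) (real (?Y k))))
        = (\<Sum>r<Q. \<Sum>s<Q. \<Sum>a<Q. \<Sum>e<Q. w r s a e * esum (poly2 d (ca (a, e))) m ?u ?v)" .
    have "(real Q)\<^sup>2 * norm (\<Sum>k<q ^ m. ee (poly2 d c (real (?X k)) (real (?Y k))))
        = norm ((of_nat Q)\<^sup>2 * (\<Sum>k<q ^ m. ee (poly2 d c (real (?X k)) (real (?Y k)))))"
      by (simp only: norm_mult norm_power norm_of_nat)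
    also have "\<dots> \<le> (\<Sum>r<Q. \<Sum>s<Q. \<Sum>a<Q. \<Sum>e<Q. \<epsilon> / (real Q)\<^sup>2 * real q ^ m)"
      unfolding eq by (intro sum_norm_le) (use m in \<open>auto simp: w_def norm_mult\<close>)
    also have "\<dots> = (real Q)\<^sup>2 * (\<epsilon> * real (q ^ m))"
      using Q0 by (simp add: field_simps power2_eq_square)
    finally show ?thesis using Q0 by simp
  qed
  then show ?thesis by blast
qed

lemma avg_tends_zero_poly2:
  assumes "has_irr_nonconst_coeff d c"
  shows "avg_tends_zero (\<lambda>n. ee (poly2 d c (real (\<kappa> (n - 1))) (real (\<sigma> (n - 1)))))"
proof (rule avg_tends_zero_of_blocks[where f = "\<lambda>n. ee (poly2 d c (real (\<kappa> n)) (real (\<sigma> n)))"])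
  fix \<epsilon> :: real assume "\<epsilon> > 0"
  from block_sums_poly2[OF assms this] obtain m where
    "\<And>n. norm (\<Sum>r<q ^ m. ee (poly2 d c (real (\<kappa> (q ^ m * n + r))) (real (\<sigma> (q ^ m * n + r)))))
            \<le> \<epsilon> * real (q ^ m)" by blast
  then show "\<exists>H>0. \<forall>k. norm (\<Sum>r<H. ee (poly2 d c (real (\<kappa> (H * k + r))) (real (\<sigma> (H * k + r)))))
            \<le> \<epsilon> * real H"
    using q_ge_2 by (intro exI[of _ "q ^ m"]) auto
qed simp

end

section \<open>Enumerating the digit set\<close>

text \<open>Reads \<open>n\<close> in base \<open>q\<close>, replaces each digit \<open>r\<close> by
  \<open>\<delta> r\<close> and evaluates in base \<open>b\<close>. The guard \<open>q < 2\<close>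
  ensures termination.\<close>

function digit_map :: "nat \<Rightarrow> nat \<Rightarrow> (nat \<Rightarrow> nat) \<Rightarrow> nat \<Rightarrow> nat" where
  "digit_map b q \<delta> n =
     (if n = 0 \<or> q < 2 then 0 else b * digit_map b q \<delta> (n div q) + \<delta> (n mod q))"
  by auto
termination
  by (relation "Wellfounded.measure (\<lambda>(b, q, \<delta>, n). n)") auto

declare digit_map.simps [simp del]

lemma digit_map_0: "digit_map b q \<delta> 0 = 0"
  by (simp add: digit_map.simps)

lemma digit_map_rec:
  assumes "q \<ge> 2" "\<delta> 0 = 0" "r < q"
  shows "digit_map b q \<delta> (q * n + r) = b * digit_map b q \<delta> n + \<delta> r"
proof (cases "q * n + r = 0")
  case True
  then have "n = 0" "r = 0" using assms by auto
  then show ?thesis using assms by (simp add: digit_map_0)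
next
  case False
  then show ?thesis using assms by (subst digit_map.simps) (auto simp: digit_map_0)
qed

text \<open>Lexicographic comparison: a smaller quotient modulo the last digit loses at least
  \<open>b\<close>, which a last digit below \<open>b\<close> cannot make up; for equal quotients
  the last digits decide.\<close>

lemma strict_mono_digit_map:
  assumes q: "q \<ge> 2" and \<delta>0: "\<delta> 0 = 0"
    and mono: "strict_mono_on {..<q} \<delta>" and less: "\<And>r. r < q \<Longrightarrow> \<delta> r < b"
  shows "strict_mono (digit_map b q \<delta>)"
proof -
  have "m < n \<Longrightarrow> digit_map b q \<delta> m < digit_map b q \<delta> n" for m n
  proof (induction n arbitrary: m rule: less_induct)
    case (less n)
    define m1 m0 n1 n0 where "m1 = m div q" and "m0 = m mod q" and "n1 = n div q" and "n0 = n mod q"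
    have eq: "m = q * m1 + m0" "n = q * n1 + n0" and lt: "m0 < q" "n0 < q"
      using q by (simp_all add: m1_def m0_def n1_def n0_def)
    have rec: "digit_map b q \<delta> m = b * digit_map b q \<delta> m1 + \<delta> m0"
      "digit_map b q \<delta> n = b * digit_map b q \<delta> n1 + \<delta> n0"
      unfolding eq using lt q \<delta>0 by (simp_all add: digit_map_rec)
    have "m1 \<le> n1" using less.prems by (simp add: m1_def n1_def div_le_mono)
    then consider "m1 = n1" | "m1 < n1" by linarith
    then show ?case
    proof cases
      case 1
      then have "m0 < n0" using less.prems eq by simp
      then have "\<delta> m0 < \<delta> n0" using mono lt by (auto simp: strict_mono_on_def)
      then show ?thesis using rec 1 by simp
    next
      case 2
      then have "n1 < n" using less.prems q by (simp add: n1_def)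
      from less.IH[OF this 2] have "digit_map b q \<delta> m1 + 1 \<le> digit_map b q \<delta> n1" by simp
      then have "b * (digit_map b q \<delta> m1 + 1) \<le> b * digit_map b q \<delta> n1" by (rule mult_le_mono2)
      moreover have "\<delta> m0 < b" using assms(4) lt by simp
      ultimately show ?thesis using rec by simp
    qed
  qed
  then show ?thesis by (simp add: strict_mono_def)
qed

lemma digit_set_Suc:
  assumes "d \<in> D" "x \<in> digit_set b D"
  shows "b * x + d \<in> digit_set b D"
proof -
  obtain k f where x: "x = (\<Sum>j\<le>k. f j * b ^ j)" and f: "\<forall>j\<le>k. f j \<in> D"
    using assms unfolding digit_set_def by auto
  define g where "g j = (case j of 0 \<Rightarrow> d | Suc i \<Rightarrow> f i)" for j
  have "b * x + d = (\<Sum>j\<le>Suc k. g j * b ^ j)"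
    by (simp only: sum.atMost_Suc_shift) (simp add: x g_def sum_distrib_left mult_ac)
  moreover have "\<forall>j\<le>Suc k. g j \<in> D" using f assms by (auto simp: g_def split: nat.split)
  ultimately show ?thesis unfolding digit_set_def by blast
qed

text \<open>Both inclusions follow by splitting off the lowest digit; leading zeros in a digit
  string are absorbed because \<open>\<delta> 0 = 0\<close>.\<close>

lemma range_digit_map:
  assumes q: "q \<ge> 2" and \<delta>0: "\<delta> 0 = 0" and bij: "bij_betw \<delta> {..<q} D"
  shows "range (digit_map b q \<delta>) = digit_set b D"
proof (intro equalityI subsetI)
  have \<delta>D: "\<delta> r \<in> D" if "r < q" for r using bij that by (auto simp: bij_betw_def)
  have "digit_map b q \<delta> n \<in> digit_set b D" for n
  proof (induction n rule: less_induct)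
    case (less n)
    show ?case
    proof (cases "n = 0")
      case True
      show ?thesis unfolding digit_set_def True digit_map_0 mem_Collect_eq
        using \<delta>D[of 0] q \<delta>0 by (intro exI[of _ 0] exI[of _ "\<lambda>_. 0"]) simp
    next
      case False
      then have "n div q < n" using q by simp
      from digit_set_Suc[OF \<delta>D less.IH[OF this], of "n mod q"] show ?thesis
        using False q by (subst digit_map.simps) simp
    qed
  qed
  then show "x \<in> digit_set b D" if "x \<in> range (digit_map b q \<delta>)" for x using that by auto
  have digit: "\<exists>r<q. d = \<delta> r" if "d \<in> D" for d
    using bij that by (force simp: bij_betw_def)
  have step: "b * x + d \<in> range (digit_map b q \<delta>)" if dx: "d \<in> D" "x \<in> range (digit_map b q \<delta>)" for x d
  proof -
    obtain r n where "r < q" "d = \<delta> r" "x = digit_map b q \<delta> n" using digit dx by blast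
    then show ?thesis using digit_map_rec[of q \<delta> r b n, OF q \<delta>0] by (metis rangeI)
  qed
  have "(\<Sum>j\<le>k. f j * b ^ j) \<in> range (digit_map b q \<delta>)" if "\<forall>j\<le>k. f j \<in> D" for k f
    using that
  proof (induction k arbitrary: f)
    case 0
    have "0 \<in> range (digit_map b q \<delta>)" using digit_map_0 by (metis rangeI)
    from step[OF _ this, of "f 0"] 0 show ?case by simp
  next
    case (Suc k)
    have "(\<Sum>j\<le>Suc k. f j * b ^ j) = b * (\<Sum>j\<le>k. f (Suc j) * b ^ j) + f 0"
      by (simp only: sum.atMost_Suc_shift) (simp add: sum_distrib_left mult_ac)
    moreover have "(\<Sum>j\<le>k. f (Suc j) * b ^ j) \<in> range (digit_map b q \<delta>)"
      by (rule Suc.IH) (use Suc.prems in auto)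
    ultimately show ?case using step[of "f 0"] Suc.prems by simp
  qed
  then show "x \<in> range (digit_map b q \<delta>)" if "x \<in> digit_set b D" for x
    using that unfolding digit_set_def by auto
qed

lemma enumerate_range_strict_mono:
  fixes f :: "nat \<Rightarrow> nat"
  assumes "strict_mono f"
  shows "enumerate (range f) n = f n"
proof (induction n)
  case 0
  have "(LEAST k. k \<in> range f) = f 0"
    by (rule Least_equality) (use assms in \<open>auto simp: strict_mono_less_eq\<close>)
  then show ?case by (simp add: enumerate_0)
next
  case (Suc n)
  have "infinite (range f)"
    using assms by (intro range_inj_infinite strict_mono_imp_inj_on)
  then have "enumerate (range f) (Suc n) = (LEAST s. s \<in> range f \<and> f n < s)"
    by (simp add: enumerate_Suc'' Suc)
  also have "\<dots> = f (Suc n)"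
    by (rule Least_equality) (use assms in \<open>auto simp: strict_mono_less_eq strict_mono_less\<close>)
  finally show ?case .
qed

lemma digsum_eq_sum_lessThan:
  assumes "b \<ge> 2" "k < K"
  shows "digsum b k = (\<Sum>j<K. (k div b ^ j) mod b)"
  unfolding digsum_def
proof (rule sum.mono_neutral_left)
  show "\<forall>j\<in>{..<K} - {..k}. k div b ^ j mod b = 0"
  proof
    fix j assume "j \<in> {..<K} - {..k}"
    then have "k < j" by simp
    also have "j < b ^ j" using assms(1) by (intro power_gt_expt) simp
    finally show "k div b ^ j mod b = 0" by simp
  qed
qed (use assms in auto)

lemma digsum_rec:
  assumes "b \<ge> 2" "d < b"
  shows "digsum b (b * k + d) = digsum b k + d"
proof -
  \<comment> \<open>One cutoff beyond both \<open>k\<close> and \<open>b * k + d\<close> allows the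
    two digit sums to be compared position by position after a shift.\<close>
  define K where "K = Suc (b * k + d)"
  have "k \<le> b * k" using assms by simp
  then have "k < K" unfolding K_def by linarith
  have "digsum b (b * k + d) = (\<Sum>j<Suc K. ((b * k + d) div b ^ j) mod b)"
    by (rule digsum_eq_sum_lessThan) (use assms in \<open>auto simp: K_def\<close>)
  also have "\<dots> = d + (\<Sum>j<K. ((b * k + d) div b ^ Suc j) mod b)"
    by (subst sum.lessThan_Suc_shift) (use assms in simp)
  also have "(\<Sum>j<K. ((b * k + d) div b ^ Suc j) mod b) = (\<Sum>j<K. (k div b ^ j) mod b)"
    using assms by (simp add: div_mult2_eq)
  also have "\<dots> = digsum b k" using digsum_eq_sum_lessThan[OF assms(1) \<open>k < K\<close>] ..
  finally show ?thesis by simp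
qed

lemma avg_tends_zero_kseq:
  assumes b: "b \<ge> 2" and D: "D \<subseteq> {0..<b}" "0 \<in> D" "2 \<le> card D"
    and irr: "has_irr_nonconst_coeff d c"
  shows "avg_tends_zero (\<lambda>n. ee (poly2 d c (real (kseq b D n)) (real (digsum b (kseq b D n)))))"
proof -
  define q where "q = card D"
  have q: "q \<ge> 2" using D by (simp add: q_def)
  have "finite D" using D finite_subset by blast
  then obtain \<delta> where bij: "bij_betw \<delta> {..<q} D" and mono: "strict_mono_on {..<q} \<delta>"
    using ex_bij_betw_strict_mono_card unfolding q_def by blast
  have \<delta>_less: "\<delta> r < b" if "r < q" for r using bij D(1) that by (auto simp: bij_betw_def)
  \<comment> \<open>Since \<open>\<delta>\<close> increases, the index of the digit 0 can only be
    0.\<close>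
  obtain r where r: "r < q" "\<delta> r = 0" using bij D(2) by (force simp: bij_betw_def)
  have \<delta>0: "\<delta> 0 = 0"
  proof (cases "r = 0")
    case False
    then show ?thesis using strict_mono_onD[OF mono, of 0 r] r by simp
  qed (use r in simp)
  have \<delta>1: "\<delta> 0 < \<delta> 1" using mono q by (auto simp: strict_mono_on_def)
  define \<kappa> where "\<kappa> = digit_map b q \<delta>"
  have rec: "\<kappa> (q * n + r) = b * \<kappa> n + \<delta> r" if "r < q" for n r
    using digit_map_rec[of q \<delta> r, OF q \<delta>0 that] by (simp add: \<kappa>_def)
  interpret digit_system b q \<delta> \<kappa> "\<lambda>n. digsum b (\<kappa> n)"
    by unfold_locales
      (use b q \<delta>0 \<delta>1 rec digsum_rec[OF b \<delta>_less] in \<open>auto simp: \<kappa>_def digit_map_0 digsum_def\<close>)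
  have "kseq b D n = \<kappa> (n - 1)" for n
    unfolding kseq_def range_digit_map[OF q \<delta>0 bij, symmetric] \<kappa>_def
    by (intro enumerate_range_strict_mono strict_mono_digit_map q \<delta>0 mono \<delta>_less)
  then show ?thesis using avg_tends_zero_poly2[OF irr] by simp
qed

section \<open>Weyl's criterion in two dimensions\<close>

inductive trig :: "(real \<Rightarrow> complex) \<Rightarrow> bool" where
  char: "trig (\<lambda>x. c * ee (of_int k * x))"
| add: "trig f \<Longrightarrow> trig g \<Longrightarrow> trig (\<lambda>x. f x + g x)"

lemma trig_const: "trig (\<lambda>x. c)"
  using trig.char[of c 0] by simp

lemma trig_mult_char: "trig f \<Longrightarrow> trig (\<lambda>x. f x * (c * ee (of_int k * x)))"
proof (induction rule: trig.induct)
  case (char c' k')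
  have "(\<lambda>x. c' * ee (of_int k' * x) * (c * ee (of_int k * x))) = (\<lambda>x. (c' * c) * ee (of_int (k' + k) * x))"
    by (simp add: ring_distribs ee_add mult_ac)
  with trig.char[of "c' * c" "k' + k"] show ?case by (simp only:)
qed (auto simp: distrib_right intro: trig.intros)

lemma trig_mult: "trig g \<Longrightarrow> trig f \<Longrightarrow> trig (\<lambda>x. f x * g x)"
  by (induction rule: trig.induct) (auto simp: distrib_left intro: trig.intros trig_mult_char)

lemma trig_diff: "trig f \<Longrightarrow> trig g \<Longrightarrow> trig (\<lambda>x. f x - g x)"
  using trig.add[OF _ trig_mult[OF trig_const[of "-1"]], of f g] by simp

text \<open>Stone--Weierstrass yields real polynomials in the point on the circle. A real linear
  functional on the complex plane has the form \<open>A * z + B * cnj z\<close>, which along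
  \<open>ee\<close> involves only the frequencies 1 and -1.\<close>

lemma trig_real_polynomial_ee:
  fixes g :: "complex \<Rightarrow> real"
  shows "real_polynomial_function g \<Longrightarrow> trig (\<lambda>x. complex_of_real (g (ee x)))"
proof (induction rule: real_polynomial_function.induct)
  case (linear f)
  then interpret f: bounded_linear f .
  have f_eq: "f z = Re z * f 1 + Im z * f \<i>" for z
  proof -
    have "z = Re z *\<^sub>R 1 + Im z *\<^sub>R \<i>" by (simp add: complex_eq_iff)
    then have "f z = f (Re z *\<^sub>R 1 + Im z *\<^sub>R \<i>)" by simp
    then show ?thesis by (simp add: f.add f.scaleR)
  qed
  define A B where "A = (of_real (f 1) - \<i> * of_real (f \<i>)) / 2"
    and "B = (of_real (f 1) + \<i> * of_real (f \<i>)) / 2"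
  have "complex_of_real (f z) = A * z + B * cnj z" for z
    by (subst f_eq) (simp add: A_def B_def complex_eq_iff field_simps)
  then have "(\<lambda>x. complex_of_real (f (ee x))) = (\<lambda>x. A * ee (of_int 1 * x) + B * ee (of_int (- 1) * x))"
    by (simp add: ee_minus)
  with trig.add[OF trig.char[of A 1] trig.char[of B "- 1"]] show ?case by (simp only:)
qed (auto intro: trig_const trig.add trig_mult)

lemma continuous_on_ee [continuous_intros]:
  "continuous_on S f \<Longrightarrow> continuous_on S (\<lambda>x. ee (f x))"
  unfolding ee_def by (intro continuous_intros)

lemma trig_continuous: "trig f \<Longrightarrow> continuous_on S f"
  by (induction rule: trig.induct) (auto intro!: continuous_intros)

lemma trig_integrable: "trig f \<Longrightarrow> f integrable_on {0..1}"
  by (intro integrable_continuous_interval trig_continuous)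

lemma integral_char: "integral {0..1} (\<lambda>x. c * ee (of_int k * x)) = (if k = 0 then c else 0)"
proof (cases "k = 0")
  case False
  define w where "w = 2 * of_real pi * \<i> * of_int k"
  have w: "w \<noteq> 0" using False by (simp add: w_def)
  have ee_w: "ee (of_int k * x) = exp (w * of_real x)" for x
    by (simp add: ee_def w_def mult_ac)
  have "((\<lambda>x. exp (w * of_real x)) has_integral (exp (w * of_real 1) / w - exp (w * of_real 0) / w)) {0..1}"
  proof (rule fundamental_theorem_of_calculus)
    fix x :: real
    have "((\<lambda>z. exp (w * z) / w) has_field_derivative exp (w * of_real x)) (at (of_real x))"
      using w by (auto intro!: derivative_eq_intros)
    then show "((\<lambda>x. exp (w * of_real x) / w) has_vector_derivative exp (w * of_real x)) (at x within {0..1})"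
      by (rule has_vector_derivative_real_field)
  qed simp
  moreover have "exp (w * of_real 1) = 1" using ee_of_int[of k] ee_w[of 1] by simp
  ultimately have "((\<lambda>x. ee (of_int k * x)) has_integral 0) {0..1}" by (simp add: ee_w)
  from integral_unique[OF has_integral_mult_right[OF this, of c]] show ?thesis using False by simp
qed simp

definition weyl2 :: "(nat \<Rightarrow> real) \<Rightarrow> (nat \<Rightarrow> real) \<Rightarrow> bool" where
  "weyl2 x y \<longleftrightarrow> (\<forall>k l :: int. (k, l) \<noteq> (0, 0) \<longrightarrow>
     (\<lambda>N. (\<Sum>n\<in>{1..N}. ee (of_int k * x n + of_int l * y n)) / of_nat N) \<longlonglongrightarrow> 0)"

text \<open>Both sides are bilinear in \<open>f\<close> and \<open>g\<close>, so characters suffice;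
  Weyl's condition removes every frequency pair except \<open>(0, 0)\<close>.\<close>

lemma weyl2_mean_trig:
  assumes W: "weyl2 x y" and "trig f" "trig g"
  shows "(\<lambda>N. (\<Sum>n\<in>{1..N}. f (x n) * g (y n)) / of_nat N) \<longlonglongrightarrow> integral {0..1} f * integral {0..1} g"
  using \<open>trig f\<close>
proof (induction rule: trig.induct)
  case (char c k)
  show ?case using \<open>trig g\<close>
  proof (induction rule: trig.induct)
    case (char c' l)
    have eq: "(\<Sum>n\<in>{1..N}. c * ee (of_int k * x n) * (c' * ee (of_int l * y n))) / of_nat N
        = c * c' * ((\<Sum>n\<in>{1..N}. ee (of_int k * x n + of_int l * y n)) / of_nat N)" for N
      by (simp add: ee_add sum_distrib_left mult_ac)
    have "(\<lambda>N. (\<Sum>n\<in>{1..N}. ee (of_int k * x n + of_int l * y n)) / of_nat N)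
        \<longlonglongrightarrow> (if k = 0 \<and> l = 0 then 1 else 0)"
    proof (cases "k = 0 \<and> l = 0")
      case True
      have "(\<lambda>N. (\<Sum>n\<in>{1..N}. ee (of_int k * x n + of_int l * y n)) / of_nat N) \<longlonglongrightarrow> 1"
      proof (rule tendsto_eventually)
        \<comment> \<open>Only eventually, since at \<open>N = 0\<close> the quotient is 0.\<close>
        show "\<forall>\<^sub>F N in sequentially. (\<Sum>n\<in>{1..N}. ee (of_int k * x n + of_int l * y n)) / of_nat N = 1"
          using eventually_gt_at_top[of 0] by eventually_elim (simp add: True)
      qed
      then show ?thesis using True by simp
    next
      case False
      then show ?thesis using W unfolding weyl2_def by auto
    qed
    from tendsto_mult_left[OF this, of "c * c'"] show ?case
      unfolding eq integral_char by (auto split: if_splits)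
  next
    case (add g1 g2)
    let ?f = "\<lambda>x. c * ee (of_int k * x)"
    have "integral {0..1} (\<lambda>x. g1 x + g2 x) = integral {0..1} g1 + integral {0..1} g2"
      by (intro Henstock_Kurzweil_Integration.integral_add trig_integrable add.hyps)
    with tendsto_add[OF add.IH] show ?case
      by (simp add: distrib_left sum.distrib add_divide_distrib)
  qed
next
  case (add f1 f2)
  have "integral {0..1} (\<lambda>x. f1 x + f2 x) = integral {0..1} f1 + integral {0..1} f2"
    by (intro Henstock_Kurzweil_Integration.integral_add trig_integrable add.hyps)
  with tendsto_add[OF add.IH] show ?case
    by (simp add: distrib_right sum.distrib add_divide_distrib)
qed

definition real_trig :: "(real \<Rightarrow> real) \<Rightarrow> bool" where
  "real_trig f \<longleftrightarrow> trig (\<lambda>x. complex_of_real (f x))"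

lemma real_trig_const: "real_trig (\<lambda>x. c)"
  unfolding real_trig_def by (rule trig_const)

lemma real_trig_diff: "real_trig f \<Longrightarrow> real_trig g \<Longrightarrow> real_trig (\<lambda>x. f x - g x)"
  unfolding real_trig_def by (simp add: trig_diff)

lemma real_trig_integrable:
  assumes "real_trig f"
  shows "f integrable_on {0..1}"
proof -
  have "continuous_on {0..1} (\<lambda>x. Re (complex_of_real (f x)))"
    using assms unfolding real_trig_def by (intro continuous_intros trig_continuous)
  then show ?thesis by (intro integrable_continuous_interval) simp
qed

lemma weyl2_mean_real_trig:
  assumes W: "weyl2 x y" and f: "real_trig f" and g: "real_trig g"
  shows "(\<lambda>N. (\<Sum>n\<in>{1..N}. f (x n) * g (y n)) / real N) \<longlonglongrightarrow> integral {0..1} f * integral {0..1} g"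
proof -
  have int: "integral {0..1} (\<lambda>x. complex_of_real (h x)) = of_real (integral {0..1} h)" if "real_trig h" for h
    using has_integral_of_real[OF integrable_integral[OF real_trig_integrable[OF that]]]
    by (rule integral_unique)
  have "(\<lambda>N. complex_of_real ((\<Sum>n\<in>{1..N}. f (x n) * g (y n)) / real N))
      \<longlonglongrightarrow> complex_of_real (integral {0..1} f * integral {0..1} g)"
    using weyl2_mean_trig[OF W f[unfolded real_trig_def] g[unfolded real_trig_def]]
    by (simp add: int f g)
  then show ?thesis by (simp only: tendsto_of_real_iff)
qed

section \<open>Trigonometric minorants and majorants of interval indicators\<close>

lemma ee_frac: "ee (frac x) = ee x"
  unfolding frac_def ee_diff by simp

text \<open>A continuous plateau \<open>h\<close> on the circle is 1 on the slightly shortened arc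
  \<open>K\<close> and 0 on the complementary arc \<open>F\<close>. It is approximated within
  \<open>\<eta>\<close>, and subtracting \<open>\<eta>\<close> makes the approximation a
  minorant.\<close>

lemma real_trig_minorant:
  assumes ab: "0 \<le> a" "b \<le> 1" and eps: "\<epsilon> > 0"
  shows "\<exists>f. real_trig f \<and> (\<forall>x. f x \<le> indicat_real {a<..<b} (frac x)) \<and> integral {0..1} f \<ge> b - a - \<epsilon>"
proof (cases "b - a \<le> \<epsilon>")
  case True
  then show ?thesis by (intro exI[of _ "\<lambda>x. 0"]) (auto simp: real_trig_const)
next
  case False
  \<comment> \<open>Shortening the arc at both ends costs \<open>2 * \<eta>\<close>; approximation
    and downward shift cost another \<open>2 * \<eta>\<close>.\<close>
  define \<eta> where "\<eta> = \<epsilon> / 4"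
  have eta: "\<eta> > 0" using eps by (simp add: \<eta>_def)
  define F where "F = ee ` ({0..a} \<union> {b..1})"
  define K where "K = ee ` {a + \<eta>..b - \<eta>}"
  have F: "compact F" "F \<noteq> {}"
    unfolding F_def using ab by (auto intro!: compact_continuous_image continuous_intros)
  have K: "compact K"
    unfolding K_def by (intro compact_continuous_image continuous_intros) simp
  have "K \<inter> F = {}"
  proof (rule ccontr)
    assume "K \<inter> F \<noteq> {}"
    then obtain s t where st: "s \<in> {a + \<eta>..b - \<eta>}" "t \<in> {0..a} \<union> {b..1}" "ee s = ee t"
      unfolding K_def F_def by blast
    have "ee t * cnj (ee t) = 1" by (metis ee_diff ee_0 diff_self)
    then have "ee (s - t) = 1" using st(3) by (simp add: ee_diff)
    then obtain k :: int where k: "s - t = of_int k" unfolding ee_eq_1_iff by (auto elim: Ints_cases)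
    have "\<bar>s - t\<bar> < 1" using st(1,2) ab eta by auto
    then have "k = 0" unfolding k by linarith
    then show False using k st(1,2) eta by auto
  qed
  then obtain \<delta> where \<delta>: "\<delta> > 0" "\<And>z w. z \<in> K \<Longrightarrow> w \<in> F \<Longrightarrow> \<delta> \<le> dist z w"
    using separate_compact_closed[OF K compact_imp_closed[OF F(1)]] by blast
  define h where "h z = min 1 (infdist z F / \<delta>)" for z
  have h01: "0 \<le> h z" "h z \<le> 1" for z using \<delta> by (auto simp: h_def infdist_nonneg)
  have hF: "h z = 0" if "z \<in> F" for z using that by (simp add: h_def)
  have hK: "h z = 1" if "z \<in> K" for z
  proof -
    have "\<delta> \<le> infdist z F" unfolding infdist_notempty[OF F(2)]
      by (rule cINF_greatest) (use F \<delta> that in auto)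
    then show ?thesis using \<delta> by (simp add: h_def)
  qed
  have "continuous_on (sphere 0 1) h"
    unfolding h_def using \<delta> by (intro continuous_intros) auto
  then obtain g where g: "real_polynomial_function g" "\<And>z. z \<in> sphere 0 1 \<Longrightarrow> \<bar>h z - g z\<bar> < \<eta>"
    using Stone_Weierstrass_real_polynomial_function[OF compact_sphere _ eta] by blast
  define f where "f x = g (ee x) - \<eta>" for x
  have gh: "\<bar>h (ee x) - g (ee x)\<bar> < \<eta>" for x by (rule g(2)) simp
  have f: "real_trig f"
    unfolding f_def by (intro real_trig_diff real_trig_const) (simp add: real_trig_def trig_real_polynomial_ee g)
  have "f x \<le> indicat_real {a<..<b} (frac x)" for x
  proof (cases "frac x \<in> {a<..<b}")
    case True
    then show ?thesis using gh[of x] h01(2)[of "ee x"] by (simp add: f_def)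
  next
    case False
    then have "frac x \<in> {0..a} \<union> {b..1}" using frac_ge_0[of x] frac_lt_1[of x] by auto
    then have "ee x \<in> F" unfolding F_def by (metis ee_frac imageI)
    then show ?thesis using gh[of x] hF False by (simp add: f_def)
  qed
  moreover have "b - a - \<epsilon> \<le> integral {0..1} f"
  proof -
    have sub: "{a + \<eta>..b - \<eta>} \<subseteq> {0..1}" using ab eta by auto
    have le: "a + \<eta> \<le> b - \<eta>" using False eps by (simp add: \<eta>_def)
    have "((\<lambda>x. 1) has_integral (b - \<eta> - (a + \<eta>))) {a + \<eta>..b - \<eta>}"
      using has_integral_const_real[of "1::real" "a + \<eta>" "b - \<eta>"] le by simp
    then have "((\<lambda>x. if x \<in> {a + \<eta>..b - \<eta>} then 1 else 0) has_integral (b - \<eta> - (a + \<eta>))) {0..1}"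
      by (subst has_integral_restrict[OF sub])
    moreover have "((\<lambda>x. 2 * \<eta>) has_integral (2 * \<eta>)) {0..1::real}"
      using has_integral_const_real[of "2 * \<eta>" 0 1] by simp
    ultimately have "((\<lambda>x. (if x \<in> {a + \<eta>..b - \<eta>} then 1 else 0) - 2 * \<eta>)
        has_integral (b - \<eta> - (a + \<eta>)) - 2 * \<eta>) {0..1}"
      by (rule has_integral_diff)
    then have "(b - \<eta> - (a + \<eta>)) - 2 * \<eta> \<le> integral {0..1} f"
    proof (rule has_integral_le[OF _ integrable_integral[OF real_trig_integrable[OF f]]])
      fix x :: real
      show "(if x \<in> {a + \<eta>..b - \<eta>} then 1 else 0) - 2 * \<eta> \<le> f x"
        using gh[of x] h01(1)[of "ee x"] hK[of "ee x"] by (auto simp: f_def K_def)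
    qed
    then show ?thesis by (simp add: \<eta>_def)
  qed
  ultimately show ?thesis using f by blast
qed

text \<open>Subtract from 1 minorants of the two complementary intervals \<open>(0, a)\<close> and
  \<open>(b, 1)\<close>, each with an error of at most \<open>\<epsilon>\<close>.\<close>

lemma real_trig_majorant:
  assumes ab: "0 \<le> a" "a < b" "b \<le> 1" and eps: "\<epsilon> > 0"
  shows "\<exists>f. real_trig f \<and> (\<forall>x. indicat_real {a<..<b} (frac x) \<le> f x) \<and> integral {0..1} f \<le> b - a + 2 * \<epsilon>"
proof -
  obtain f1 where f1: "real_trig f1" "\<And>x. f1 x \<le> indicat_real {0<..<a} (frac x)" "integral {0..1} f1 \<ge> a - 0 - \<epsilon>"
    using real_trig_minorant[of 0 a \<epsilon>] assms by auto
  obtain f2 where f2: "real_trig f2" "\<And>x. f2 x \<le> indicat_real {b<..<1} (frac x)" "integral {0..1} f2 \<ge> 1 - b - \<epsilon>"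
    using real_trig_minorant[of b 1 \<epsilon>] assms by auto
  let ?f = "\<lambda>x. 1 - f1 x - f2 x"
  have "real_trig ?f" by (intro real_trig_diff real_trig_const f1 f2)
  moreover have "indicat_real {a<..<b} (frac x) \<le> ?f x" for x
  proof -
    have "indicat_real {0<..<a} t + indicat_real {b<..<1} t + indicat_real {a<..<b} t \<le> 1" for t
      using ab by (auto simp: indicator_def)
    from this[of "frac x"] show ?thesis using f1(2)[of x] f2(2)[of x] by linarith
  qed
  moreover have "integral {0..1} ?f = 1 - integral {0..1} f1 - integral {0..1} f2"
    by (simp add: Henstock_Kurzweil_Integration.integral_diff real_trig_integrable f1 f2
        real_trig_const real_trig_diff integrable_diff)
  ultimately show ?thesis using f1(3) f2(3) by (intro exI[of _ ?f]) auto
qed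

lemma ud_mod1_2_weyl:
  assumes W: "weyl2 x y"
  shows "ud_mod1_2 (\<lambda>n. (x n, y n))"
  unfolding ud_mod1_2_def fst_conv snd_conv
proof (intro allI impI)
  fix a b c d :: real
  assume "0 \<le> a \<and> a < b \<and> b \<le> 1 \<and> 0 \<le> c \<and> c < d \<and> d \<le> 1"
  then have ab: "0 \<le> a" "a < b" "b \<le> 1" and cd: "0 \<le> c" "c < d" "d \<le> 1" by auto
  define I where "I n = indicat_real {a<..<b} (frac (x n))" for n
  define J where "J n = indicat_real {c<..<d} (frac (y n))" for n
  define p where "p N = (\<Sum>n\<in>{1..N}. I n * J n) / real N" for N
  have "real (card {n\<in>{1..N}. frac (x n) \<in> {a<..<b} \<and> frac (y n) \<in> {c<..<d}}) = (\<Sum>n\<in>{1..N}. I n * J n)" for N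
  proof -
    have "(\<Sum>n\<in>{1..N}. I n * J n)
        = (\<Sum>n\<in>{1..N}. if frac (x n) \<in> {a<..<b} \<and> frac (y n) \<in> {c<..<d} then 1 else 0)"
      by (intro sum.cong refl) (auto simp: I_def J_def)
    then show ?thesis by (simp add: sum.If_cases Int_def)
  qed
  then have p: "real (card {n\<in>{1..N}. frac (x n) \<in> {a<..<b} \<and> frac (y n) \<in> {c<..<d}}) / real N = p N" for N
    by (simp add: p_def)
  have "p \<longlonglongrightarrow> (b - a) * (d - c)"
  proof (rule LIMSEQ_I)
    fix e :: real assume e: "e > 0"
    \<comment> \<open>The cap at 1 absorbs quadratic error terms, so both integral bounds below are
      within \<open>8 * \<epsilon>\<close> of the area, less than \<open>e\<close>.\<close>
    define \<epsilon> where "\<epsilon> = min 1 (e / 16)"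
    have eps: "\<epsilon> > 0" "\<epsilon> \<le> 1" "16 * \<epsilon> \<le> e" using e by (auto simp: \<epsilon>_def)
    obtain f where f: "real_trig f" "\<And>x. f x \<le> indicat_real {a<..<b} (frac x)" "integral {0..1} f \<ge> b - a - \<epsilon>"
      using real_trig_minorant[of a b \<epsilon>] ab eps by auto
    obtain g where g: "real_trig g" "\<And>x. g x \<le> indicat_real {c<..<d} (frac x)" "integral {0..1} g \<ge> d - c - \<epsilon>"
      using real_trig_minorant[of c d \<epsilon>] cd eps by auto
    obtain F where F: "real_trig F" "\<And>x. indicat_real {a<..<b} (frac x) \<le> F x" "integral {0..1} F \<le> b - a + 2 * \<epsilon>"
      using real_trig_majorant[of a b \<epsilon>] ab eps by auto
    obtain G where G: "real_trig G" "\<And>x. indicat_real {c<..<d} (frac x) \<le> G x" "integral {0..1} G \<le> d - c + 2 * \<epsilon>"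
      using real_trig_majorant[of c d \<epsilon>] cd eps by auto
    have pos: "0 \<le> integral {0..1} F" "0 \<le> integral {0..1} G"
      using order.trans[OF indicator_pos_le F(2)] order.trans[OF indicator_pos_le G(2)]
      by (auto intro!: Henstock_Kurzweil_Integration.integral_nonneg real_trig_integrable F(1) G(1))
    define U where "U N = (\<Sum>n\<in>{1..N}. F (x n) * G (y n)) / real N" for N
    \<comment> \<open>The product of the minorants need not be a minorant, as both may be negative.
      Instead \<open>I * J = I - I * (1 - J)\<close> is bounded below by
      \<open>f - F * (1 - g)\<close>, where \<open>F\<close> and \<open>1 - g\<close> dominate
      nonnegative functions.\<close>
    define V where "V N = (\<Sum>n\<in>{1..N}. f (x n) * 1) / real N - (\<Sum>n\<in>{1..N}. F (x n) * (1 - g (y n))) / real N" for N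
    have U: "U \<longlonglongrightarrow> integral {0..1} F * integral {0..1} G"
      unfolding U_def by (intro weyl2_mean_real_trig W F G)
    have "integral {0..1} (\<lambda>x. 1 - g x) = 1 - integral {0..1} g"
      by (simp add: Henstock_Kurzweil_Integration.integral_diff real_trig_integrable g(1) real_trig_const)
    moreover have "V \<longlonglongrightarrow> integral {0..1} f * integral {0..1 :: real} (\<lambda>x. 1)
        - integral {0..1} F * integral {0..1} (\<lambda>x. 1 - g x)"
      unfolding V_def
      by (intro tendsto_diff weyl2_mean_real_trig[OF W f(1) real_trig_const[of 1]]
          weyl2_mean_real_trig[OF W F(1) real_trig_diff[OF real_trig_const[of 1] g(1)]])
    ultimately have V: "V \<longlonglongrightarrow> integral {0..1} f - integral {0..1} F * (1 - integral {0..1} g)"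
      by simp
    have pU: "p N \<le> U N" for N
      unfolding p_def U_def
      by (intro divide_right_mono sum_mono mult_mono) (auto simp: I_def J_def F G intro: order.trans[OF indicator_pos_le F(2)])
    have Vp: "V N \<le> p N" for N
      unfolding p_def V_def diff_divide_distrib[symmetric] sum_subtractf[symmetric]
    proof (intro divide_right_mono sum_mono)
      fix n
      have "I n * (1 - J n) \<le> F (x n) * (1 - g (y n))"
        using F(2)[of "x n"] g(2)[of "y n"] order.trans[OF indicator_pos_le F(2), of "x n"]
        by (intro mult_mono) (auto simp: I_def J_def indicator_def)
      then show "f (x n) * 1 - F (x n) * (1 - g (y n)) \<le> I n * J n"
        using f(2)[of "x n"] by (simp add: I_def algebra_simps)
    qed simp
    have ab1: "b - a \<le> 1" and cd1: "d - c \<le> 1" using ab cd by auto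
    have up: "integral {0..1} F * integral {0..1} G \<le> (b - a) * (d - c) + 8 * \<epsilon>"
    proof -
      have "integral {0..1} F * integral {0..1} G \<le> (b - a + 2 * \<epsilon>) * (d - c + 2 * \<epsilon>)"
        using F G pos eps ab by (intro mult_mono) auto
      also have "\<dots> = (b - a) * (d - c) + 2 * \<epsilon> * ((b - a) + (d - c) + 2 * \<epsilon>)"
        by (simp add: algebra_simps)
      also have "\<dots> \<le> (b - a) * (d - c) + 2 * \<epsilon> * 4"
        using ab1 cd1 eps by (intro add_left_mono mult_left_mono) auto
      finally show ?thesis by simp
    qed
    have low: "(b - a) * (d - c) - 8 * \<epsilon> \<le> integral {0..1} f - integral {0..1} F * (1 - integral {0..1} g)"
    proof -
      have "integral {0..1} F * (1 - integral {0..1} g) \<le> integral {0..1} F * (1 - (d - c) + \<epsilon>)"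
        using g(3) pos by (intro mult_left_mono) auto
      also have "\<dots> \<le> (b - a + 2 * \<epsilon>) * (1 - (d - c) + \<epsilon>)"
        using F(3) cd1 eps by (intro mult_right_mono) auto
      also have "\<dots> = (b - a) - (b - a) * (d - c) + (b - a) * \<epsilon> + 2 * \<epsilon> * (1 - (d - c) + \<epsilon>)"
        by (simp add: algebra_simps)
      also have "\<dots> \<le> (b - a) - (b - a) * (d - c) + 1 * \<epsilon> + 2 * \<epsilon> * 2"
        using ab1 cd eps by (intro add_mono mult_left_mono mult_right_mono) auto
      finally show ?thesis using f(3) eps by simp
    qed
    have "\<forall>\<^sub>F N in sequentially. U N < (b - a) * (d - c) + e"
      by (rule order_tendstoD(2)[OF U]) (use up eps e in linarith)
    moreover have "\<forall>\<^sub>F N in sequentially. (b - a) * (d - c) - e < V N"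
      by (rule order_tendstoD(1)[OF V]) (use low eps e in linarith)
    ultimately have "\<forall>\<^sub>F N in sequentially. norm (p N - (b - a) * (d - c)) < e"
    proof eventually_elim
      case (elim N)
      then show ?case using pU[of N] Vp[of N] by (simp add: abs_less_iff)
    qed
    then show "\<exists>no. \<forall>n\<ge>no. norm (p n - (b - a) * (d - c)) < e"
      by (simp add: eventually_sequentially)
  qed
  then show "(\<lambda>N. real (card {n\<in>{1..N}. frac (x n) \<in> {a<..<b} \<and> frac (y n) \<in> {c<..<d}}) / real N)
      \<longlonglongrightarrow> (b - a) * (d - c)"
    by (simp only: p)
qed

section \<open>From uniform averages to uniform distribution\<close>

lemma avg_tends_zero_imp_tendsto:
  assumes "avg_tends_zero f"
  shows "(\<lambda>N. (\<Sum>n\<in>{1..N}. f n) / of_nat N) \<longlonglongrightarrow> 0"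
proof (rule LIMSEQ_I)
  fix e :: real assume "e > 0"
  with assms obtain L where L: "\<And>M N. M < N \<Longrightarrow> N - M \<ge> L \<Longrightarrow>
      norm ((\<Sum>n\<in>{M<..N}. f n) / of_nat (N - M)) < e"
    unfolding avg_tends_zero_def by blast
  \<comment> \<open>The case \<open>M = 0\<close> of the uniform bound; \<open>Suc L\<close> also
    guarantees \<open>0 < N\<close>.\<close>
  have "norm ((\<Sum>n\<in>{1..N}. f n) / of_nat N - 0) < e" if "N \<ge> Suc L" for N
  proof -
    have "{0<..N} = {1..N}" by auto
    then show ?thesis using L[of 0 N] that by simp
  qed
  then show "\<exists>no. \<forall>N\<ge>no. norm ((\<Sum>n\<in>{1..N}. f n) / of_nat N - 0) < e" by blast
qed

lemma avg_tends_zero_kseq_combination: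
  fixes m1 m2 :: int
  assumes "b \<ge> 2" "D \<subseteq> {0..<b}" "0 \<in> D" "2 \<le> card D"
    and "has_irr_nonconst_coeff d (\<lambda>i j. of_int m1 * c1 i j + of_int m2 * c2 i j)"
  shows "avg_tends_zero (\<lambda>n. ee (of_int m1 * poly2 d c1 (real (kseq b D n)) (real (digsum b (kseq b D n)))
      + of_int m2 * poly2 d c2 (real (kseq b D n)) (real (digsum b (kseq b D n)))))"
  using avg_tends_zero_kseq[OF assms] by (simp add: poly2_add poly2_cmult)

theorem mainTheorem7:
  fixes b :: nat and D :: "nat set"
  assumes "b \<ge> 3" and "D \<subseteq> {0..<b}" and "0 \<in> D" and "2 \<le> card D" and "card D < b"
  shows "(\<forall>d c. has_irr_nonconst_coeff d c \<longrightarrow>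
            avg_tends_zero (\<lambda>n. ee (poly2 d c (real (kseq b D n)) (real (digsum b (kseq b D n))))))
       \<and> (\<forall>d c1 c2. (\<forall>m1 m2 :: int. (m1, m2) \<noteq> (0, 0) \<longrightarrow>
                       has_irr_nonconst_coeff d (\<lambda>i j. of_int m1 * c1 i j + of_int m2 * c2 i j)) \<longrightarrow>
            ud_mod1_2 (\<lambda>n. (poly2 d c1 (real (kseq b D n)) (real (digsum b (kseq b D n))),
                            poly2 d c2 (real (kseq b D n)) (real (digsum b (kseq b D n)))))
          \<and> (\<forall>m1 m2 :: int. (m1, m2) \<noteq> (0, 0) \<longrightarrow>
               avg_tends_zero (\<lambda>n. ee (of_int m1 * poly2 d c1 (real (kseq b D n)) (real (digsum b (kseq b D n)))
                                      + of_int m2 * poly2 d c2 (real (kseq b D n)) (real (digsum b (kseq b D n)))))))"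
proof (intro conjI allI impI)
  have b: "b \<ge> 2" using assms(1) by simp
  note digits = b assms(2-4)
  show "avg_tends_zero (\<lambda>n. ee (poly2 d c (real (kseq b D n)) (real (digsum b (kseq b D n)))))"
    if "has_irr_nonconst_coeff d c" for d c
    using avg_tends_zero_kseq[OF digits that] .
  fix d c1 c2
  assume irr: "\<forall>m1 m2 :: int. (m1, m2) \<noteq> (0, 0) \<longrightarrow>
    has_irr_nonconst_coeff d (\<lambda>i j. of_int m1 * c1 i j + of_int m2 * c2 i j)"
  have comb: "avg_tends_zero (\<lambda>n. ee (of_int m1 * poly2 d c1 (real (kseq b D n)) (real (digsum b (kseq b D n)))
      + of_int m2 * poly2 d c2 (real (kseq b D n)) (real (digsum b (kseq b D n)))))"
    if "(m1, m2) \<noteq> (0, 0)" for m1 m2 :: int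
    using avg_tends_zero_kseq_combination[OF digits irr[rule_format, OF that]] .
  then show "avg_tends_zero (\<lambda>n. ee (of_int m1 * poly2 d c1 (real (kseq b D n)) (real (digsum b (kseq b D n)))
      + of_int m2 * poly2 d c2 (real (kseq b D n)) (real (digsum b (kseq b D n)))))"
    if "(m1, m2) \<noteq> (0, 0)" for m1 m2 :: int
    using that .
  show "ud_mod1_2 (\<lambda>n. (poly2 d c1 (real (kseq b D n)) (real (digsum b (kseq b D n))),
                            poly2 d c2 (real (kseq b D n)) (real (digsum b (kseq b D n)))))"
    \<comment> \<open>Weyl's condition for the pair is the case \<open>M = 0\<close> of
      \<open>comb\<close>.\<close>
    unfolding weyl2_def
    by (intro ud_mod1_2_weyl[unfolded weyl2_def] allI impI avg_tends_zero_imp_tendsto comb)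
qed

end
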